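(* Every graph with two edge-disjoint spanning triangle-trees has flow index strictly less than $3$.
   Context: Graphs are finite, may contain parallel edges, but have no loops. Triangle-tree: a graph formed by starting with a triangle $x_1x_2x_3$ and then repeatedly (zero or more times) adding a new vertex $x_{j+1}$ joined to exactly two vertices $y,z$ that are adjacent in the graph already constructed (so $x_{j+1},y,z$ form a triangle). A spanning triangle-tree of $G$ is a subgraph of $G$ that is a triangle-tree and contains all vertices of $G$. Nowhere-zero $t$-flow: a pair $(D,f)$ where $D$ is an orientation of $G$ and $f:E(G)\to\{\pm1,\dots,\pm(t-1)\}$ satisfies $\sum_{e\in E_D^+(v)}f(e)=\sum_{e\in E_D^-(v)}f(e)$ for every vertex $v$, where $E_D^+(v)$, $E_D^-(v)$ are the sets of arcs leaving and entering $v$. For integers $t\ge 2s>0$, a circular $t/s$-flow of $G$ is a nowhere-zero $t$-flow $(D,f)$ with $s\le |f(e)|\le t-s$ for every edge $e$. The flow index of $G$ is the least rational number $r$ such that $G$ has a circular $r$-flow. *)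

theory Defs
  imports Complex_Main "Graph_Theory.Digraph"
begin

text \<open>
  Undirected multigraphs: edges are abstract elements and \<open>ends\<close> sends an edge to its set of
  end vertices, so parallel edges are distinct edges with the same ends. Only the values of
  \<open>ends\<close> on \<open>edges\<close> are meaningful.
\<close>

record ('v, 'e) mgraph =
  nodes :: "'v set"
  edges :: "'e set"
  ends :: "'e \<Rightarrow> 'v set"

definition multigraph :: "('v, 'e) mgraph \<Rightarrow> bool" where
  "multigraph G \<longleftrightarrow> finite (nodes G) \<and> finite (edges G) \<and>
     (\<forall>e\<in>edges G. ends G e \<subseteq> nodes G \<and> card (ends G e) = 2)"

definition sub_multigraph :: "('v, 'e) mgraph \<Rightarrow> ('v, 'e) mgraph \<Rightarrow> bool" where
  "sub_multigraph H G \<longleftrightarrow> multigraph H \<and> multigraph G \<and>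
     nodes H \<subseteq> nodes G \<and> edges H \<subseteq> edges G \<and> (\<forall>e\<in>edges H. ends H e = ends G e)"

inductive triangle_tree :: "('v, 'e) mgraph \<Rightarrow> bool" where
  triangle:
    "\<lbrakk> distinct [x1, x2, x3]; distinct [e1, e2, e3];
       nodes H = {x1, x2, x3}; edges H = {e1, e2, e3};
       ends H e1 = {x1, x2}; ends H e2 = {x2, x3}; ends H e3 = {x1, x3} \<rbrakk>
     \<Longrightarrow> triangle_tree H"
| add_vertex:
    "\<lbrakk> triangle_tree H; x \<notin> nodes H; e \<in> edges H; ends H e = {y, z}; y \<noteq> z;
       e1 \<noteq> e2; e1 \<notin> edges H; e2 \<notin> edges H;
       nodes H' = insert x (nodes H); edges H' = {e1, e2} \<union> edges H;
       \<forall>e'\<in>edges H. ends H' e' = ends H e';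
       ends H' e1 = {x, y}; ends H' e2 = {x, z} \<rbrakk>
     \<Longrightarrow> triangle_tree H'"

definition spanning_triangle_tree :: "('v, 'e) mgraph \<Rightarrow> ('v, 'e) mgraph \<Rightarrow> bool" where
  "spanning_triangle_tree T G \<longleftrightarrow>
     sub_multigraph T G \<and> triangle_tree T \<and> nodes T = nodes G"

text \<open>
  An orientation is a digraph with the same vertices and with the edges themselves as arcs; it
  picks, for each edge, which end is the tail and which is the head.
\<close>

definition orientation :: "('v, 'e) mgraph \<Rightarrow> ('v, 'e) pre_digraph \<Rightarrow> bool" where
  "orientation G D \<longleftrightarrow> verts D = nodes G \<and> arcs D = edges G \<and>
     (\<forall>e\<in>edges G. ends G e = {tail D e, head D e})"

definition nowhere_zero_flow ::
  "('v, 'e) mgraph \<Rightarrow> int \<Rightarrow> ('v, 'e) pre_digraph \<Rightarrow> ('e \<Rightarrow> int) \<Rightarrow> bool" where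
  "nowhere_zero_flow G t D f \<longleftrightarrow> orientation G D \<and>
     (\<forall>e\<in>edges G. 1 \<le> \<bar>f e\<bar> \<and> \<bar>f e\<bar> \<le> t - 1) \<and>
     (\<forall>v\<in>nodes G. (\<Sum>e\<in>out_arcs D v. f e) = (\<Sum>e\<in>in_arcs D v. f e))"

definition circular_flow ::
  "('v, 'e) mgraph \<Rightarrow> int \<Rightarrow> int \<Rightarrow> ('v, 'e) pre_digraph \<Rightarrow> ('e \<Rightarrow> int) \<Rightarrow> bool" where
  "circular_flow G t s D f \<longleftrightarrow> t \<ge> 2 * s \<and> s > 0 \<and> nowhere_zero_flow G t D f \<and>
     (\<forall>e\<in>edges G. s \<le> \<bar>f e\<bar> \<and> \<bar>f e\<bar> \<le> t - s)"

text \<open>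
  For a rational number \<open>r\<close>, a circular \<open>r\<close>-flow is a circular \<open>t/s\<close>-flow for some
  representation \<open>r = t/s\<close>, not necessarily in lowest terms.
\<close>

definition has_circular_flow :: "('v, 'e) mgraph \<Rightarrow> rat \<Rightarrow> bool" where
  "has_circular_flow G r \<longleftrightarrow>
     (\<exists>t s D f. r = of_int t / of_int s \<and> circular_flow G t s D f)"

text \<open>
  Stated as a relation because a graph with a bridge has no circular flow at all, and hence
  no flow index.
\<close>

definition is_flow_index :: "('v, 'e) mgraph \<Rightarrow> rat \<Rightarrow> bool" where
  "is_flow_index G r \<longleftrightarrow>
     has_circular_flow G r \<and> (\<forall>r'. has_circular_flow G r' \<longrightarrow> r \<le> r')"

end

(*
  By Hoffman's circulation theorem, a strong orientation with all boundaries divisible by 3 yields a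
  circular r-flow with r < 3. Orienting the first triangle-tree T1 together with all edges outside T2
  strongly, one ear or edge at a time, leaves one binary choice per ear and per additional edge, and
  each choice shifts the boundary modulo 3 by a difference 1_y - 1_z. The second tree T2 must realize
  the opposite boundary. The zero-sum boundaries that T2 cannot realize are combinations
  sum_t c_t 1_t, with all c_t nonzero, of the linearly independent indicators of its n - 2 triangles;
  so shifts that never leave this set have pairwise disjoint supports of size at least 2. Counting
  leaves only n = 3 and n = 4 without additional edges, which are settled by hand.
*)

theory Submission
  imports Defs "HOL-Library.Numeral_Type" "HOL-Library.Function_Algebras"
begin

section \<open>Boundaries of orientations modulo 3\<close>

text \<open>Boundaries divisible by 3 alone would only give the value 3: they turn the orientation
  into a flow with values 1 and -2. Strictness comes from strong connectivity, which supplies a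
  positive circulation to push these values off the extremes. Hence the asymmetric roles: T1 secures
  strongness, T2 only corrects the boundary. The obstacle is that T2 cannot correct everything. A
  triangle realizes every zero-sum boundary modulo 3 except the two nonzero constants, and each ear
  passes the defect on, since a nonzero boundary at the ear vertex forces both ear edges and so adds
  a multiple of the new triangle's indicator. The way out is the freedom left in T1: if two shifts
  change the same nonzero coefficient p by nonzero amounts q and r, then one of p+q, p+r, p+q+r
  vanishes modulo 3. The count is tight on four vertices, where one dipole can use both triangles of
  T2, namely as the difference of their indicators.\<close>

lemma three_cases:
  fixes c :: 3
  obtains "c = 0" | "c = 1" | "c = -1"
proof (cases c)
  case (of_int z)
  then have "z = 0 \<or> z = 1 \<or> z = 2" by auto
  then show thesis using of_int that by auto
qed

lemma add_self_three [simp]: "(c :: 3) + c = - c"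
  by (cases c rule: three_cases) simp_all

lemma three_mult [simp]: "3 * (c :: 3) = 0"
  by (cases c rule: three_cases) simp_all

lemma sum_fun_apply: "(\<Sum>i\<in>A. f i) v = (\<Sum>i\<in>A. f i v)"
  by (induction A rule: infinite_finite_induct) simp_all

definition arc :: "'v \<times> 'v \<Rightarrow> 'v \<Rightarrow> 3" where
  "arc p v = of_bool (v = fst p) - of_bool (v = snd p)"

abbreviation dipole :: "'v \<Rightarrow> 'v \<Rightarrow> 'v \<Rightarrow> 3" where
  "dipole y z \<equiv> arc (y, z)"

text \<open>Orientations are functions from edges to pairs (tail, head), so that reversing an edge
  is a function update; an actual digraph is built only in
  \<open>has_circular_flowI\<close>.\<close>

definition orients :: "('e \<Rightarrow> 'v set) \<Rightarrow> 'e set \<Rightarrow> ('e \<Rightarrow> 'v \<times> 'v) \<Rightarrow> bool" where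
  "orients en E p \<longleftrightarrow> (\<forall>e\<in>E. en e = {fst (p e), snd (p e)})"

definition realizable :: "('e \<Rightarrow> 'v set) \<Rightarrow> 'e set \<Rightarrow> ('v \<Rightarrow> 3) \<Rightarrow> bool" where
  "realizable en E g \<longleftrightarrow> (\<exists>p. orients en E p \<and> (\<Sum>e\<in>E. arc (p e)) = g)"

definition zero_sum :: "'v set \<Rightarrow> ('v \<Rightarrow> 3) \<Rightarrow> bool" where
  "zero_sum V g \<longleftrightarrow> (\<forall>v. v \<notin> V \<longrightarrow> g v = 0) \<and> (\<Sum>v\<in>V. g v) = 0"

lemma dipole_swap: "dipole z y = - dipole y z"
  by (simp add: arc_def fun_eq_iff)

lemma zero_sum_add: "zero_sum V g \<Longrightarrow> zero_sum V h \<Longrightarrow> zero_sum V (g + h)"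
  by (simp add: zero_sum_def sum.distrib)

lemma zero_sum_uminus: "zero_sum V g \<Longrightarrow> zero_sum V (- g)"
  by (simp add: zero_sum_def sum_negf)

lemma zero_sum_diff: "zero_sum V g \<Longrightarrow> zero_sum V h \<Longrightarrow> zero_sum V (g - h)"
  by (simp add: zero_sum_def sum_subtractf)

lemma zero_sum_sum: "(\<And>i. i \<in> A \<Longrightarrow> zero_sum V (f i)) \<Longrightarrow> zero_sum V (\<Sum>i\<in>A. f i)"
proof (induction A rule: infinite_finite_induct)
  case (insert i A)
  then have "zero_sum V (f i + sum f A)" by (intro zero_sum_add) auto
  then show ?case by (metis insert.hyps sum.insert)
qed (simp_all add: zero_sum_def)

lemma zero_sum_arc:
  assumes "finite V" "fst p \<in> V" "snd p \<in> V"
  shows "zero_sum V (arc p)"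
  using assms by (auto simp: zero_sum_def arc_def sum_subtractf of_bool_def)

lemma zero_sum_remove:
  assumes "finite V" "x \<notin> V" "zero_sum (insert x V) g" "g x = 0"
  shows "zero_sum V g"
  using assms by (auto simp: zero_sum_def)

lemma realizable_insert:
  assumes "finite E" "e \<notin> E" "en e = {y, z}" "realizable en E g"
  shows "realizable en (insert e E) (g + dipole y z)"
proof -
  obtain p where p: "orients en E p" "(\<Sum>e\<in>E. arc (p e)) = g"
    using assms(4) by (auto simp: realizable_def)
  have "(\<Sum>e'\<in>E. arc ((p(e := (y, z))) e')) = (\<Sum>e'\<in>E. arc (p e'))"
    using assms(2) by (intro sum.cong) auto
  then have "(\<Sum>e'\<in>insert e E. arc ((p(e := (y, z))) e')) = g + dipole y z"
    using assms(1,2) p(2) by (simp add: add.commute)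
  moreover have "orients en (insert e E) (p(e := (y, z)))"
    using p(1) assms(3) by (auto simp: orients_def)
  ultimately show ?thesis unfolding realizable_def by blast
qed

text \<open>Reversing an arc subtracts it twice, which modulo 3 is adding it once. The sign of the
  dipole is dictated by the direction of \<open>e\<close> in the given realization, hence the
  disjunction.\<close>

lemma realizable_flip:
  assumes "finite E" "e \<in> E" "en e = {y, z}" "realizable en E g"
  shows "realizable en E (g + dipole y z) \<or> realizable en E (g - dipole y z)"
proof -
  obtain p where p: "orients en E p" "(\<Sum>e\<in>E. arc (p e)) = g"
    using assms(4) by (auto simp: realizable_def)
  define q where "q = p(e := (snd (p e), fst (p e)))"
  have pe: "p e = (y, z) \<or> p e = (z, y)"
    using p(1) assms(2,3) by (cases "p e") (auto simp: orients_def doubleton_eq_iff)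
  have "(\<Sum>e\<in>E. arc (q e)) = arc (q e) + (\<Sum>e\<in>E - {e}. arc (q e))"
    using assms(1,2) by (rule sum.remove)
  also have "(\<Sum>e\<in>E - {e}. arc (q e)) = (\<Sum>e\<in>E - {e}. arc (p e))"
    by (intro sum.cong) (auto simp: q_def)
  also have "\<dots> = g - arc (p e)"
    using sum.remove[OF assms(1,2), of "\<lambda>e. arc (p e)"] p(2) by (metis add_diff_cancel_left')
  also have "arc (q e) + (g - arc (p e)) = g + arc (p e)"
  proof
    fix v
    have "arc (q e) v = - arc (p e) v" by (simp add: q_def arc_def)
    then show "(arc (q e) + (g - arc (p e))) v = (g + arc (p e)) v"
      using add_self_three[of "arc (p e) v"] by (simp add: algebra_simps)
  qed
  finally have "(\<Sum>e\<in>E. arc (q e)) = g + arc (p e)" .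
  moreover have "orients en E q"
    using p(1) by (auto simp: orients_def q_def insert_commute)
  ultimately have "realizable en E (g + arc (p e))"
    unfolding realizable_def by blast
  then show ?thesis using pe by (auto simp: dipole_swap[of z y])
qed

section \<open>Boundaries that a triangle-tree realizes\<close>

text \<open>One end map \<open>en\<close> serves all stages and both trees, whereas every stage of
  \<open>triangle_tree\<close> is a record with its own \<open>ends\<close>.\<close>

inductive ttree :: "('e \<Rightarrow> 'v set) \<Rightarrow> 'v set \<Rightarrow> 'e set \<Rightarrow> bool" for en where
  base: "\<lbrakk>distinct [x1, x2, x3]; distinct [e1, e2, e3];
      en e1 = {x1, x2}; en e2 = {x2, x3}; en e3 = {x1, x3}\<rbrakk>
    \<Longrightarrow> ttree en {x1, x2, x3} {e1, e2, e3}"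
| ear: "\<lbrakk>ttree en V E; x \<notin> V; e \<in> E; en e = {y, z}; y \<noteq> z;
      e1 \<noteq> e2; e1 \<notin> E; e2 \<notin> E; en e1 = {x, y}; en e2 = {x, z}\<rbrakk>
    \<Longrightarrow> ttree en (insert x V) (insert e1 (insert e2 E))"

lemma triangle_tree_imp_ttree:
  assumes "triangle_tree T" "\<forall>e\<in>edges T. ends T e = en e"
  shows "ttree en (nodes T) (edges T)"
  using assms
proof (induction rule: triangle_tree.induct)
  case (triangle x1 x2 x3 e1 e2 e3 H)
  then have "ttree en {x1, x2, x3} {e1, e2, e3}"
    by (intro ttree.base) auto
  with triangle show ?case by simp
next
  case (add_vertex H x e y z e1 e2 H')
  then have "ttree en (insert x (nodes H)) (insert e1 (insert e2 (edges H)))"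
    by (intro ttree.ear[where e = e and y = y and z = z]) auto
  with add_vertex show ?case by simp
qed

lemma ttree_finite:
  "ttree en V E \<Longrightarrow> finite V \<and> finite E \<and> 3 \<le> card V \<and> (\<forall>e\<in>E. en e \<subseteq> V)"
  by (induction rule: ttree.induct) auto

lemma realizable_empty: "realizable en {} 0"
  by (auto simp: realizable_def orients_def)

text \<open>For zero-sum \<open>g\<close> the last hypothesis excludes exactly the two nonzero
  constants: if \<open>g x1 = g x2 = c\<close> with \<open>c\<close> nonzero, then
  \<open>g x3 = - 2 * c = c\<close>. The other seven boundaries are 0, from the cyclic orientations,
  and the six from the transitive ones.\<close>

lemma realizable_triangle:
  assumes "distinct [x1, x2, x3]" "distinct [e1, e2, e3]"
    "en e1 = {x1, x2}" "en e2 = {x2, x3}" "en e3 = {x1, x3}"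
    "zero_sum {x1, x2, x3} g" "g x1 = 0 \<or> g x1 \<noteq> g x2"
  shows "realizable en {e1, e2, e3} g"
proof -
  have r: "realizable en {e1, e2, e3} (0 + arc p + arc q + arc r)"
    if "{fst p, snd p} = {x1, x3}" "{fst q, snd q} = {x2, x3}" "{fst r, snd r} = {x1, x2}" for p q r
  proof -
    have "realizable en {e3} (0 + arc p)"
      using realizable_insert[of "{}" e3 en "fst p" "snd p" 0] realizable_empty[of en] assms(5) that(1)
      by simp
    then have "realizable en {e2, e3} (0 + arc p + arc q)"
      using realizable_insert[of "{e3}" e2 en "fst q" "snd q" "0 + arc p"] assms(2,4) that(2) by simp
    then show ?thesis
      using realizable_insert[of "{e2, e3}" e1 en "fst r" "snd r" "0 + arc p + arc q"] assms(2,3) that(3)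
      by simp
  qed
  \<comment> \<open>The signs say whether each edge follows the cycle from \<open>x1\<close> over
    \<open>x2\<close> and \<open>x3\<close> back to \<open>x1\<close>.\<close>
  have ex: "\<exists>s1\<in>{1, -1}. \<exists>s2\<in>{1, -1}. \<exists>s3\<in>{1, -1}. a = s1 - s3 \<and> b = s2 - s1"
    if "a = 0 \<or> a \<noteq> b" for a b :: 3
    using that by (cases a rule: three_cases; cases b rule: three_cases) auto
  obtain s1 s2 s3 where s: "s1 \<in> {1, -1}" "s2 \<in> {1, -1}" "s3 \<in> {1, -1}"
    "g x1 = s1 - s3" "g x2 = s2 - s1"
    using ex[OF assms(7)] by (elim bexE conjE) (rule that)
  have g0: "g v = 0" if "v \<notin> {x1, x2, x3}" for v
    using assms(6) that by (simp add: zero_sum_def)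
  have "(g x1 + g x2) + g x3 = 0"
    using assms(1,6) by (simp add: zero_sum_def add.assoc)
  then have "g x3 = - (g x1 + g x2)" by (rule minus_unique[symmetric])
  also have "\<dots> = s3 - s2" unfolding s(4,5) by simp
  finally have g3: "g x3 = s3 - s2" .
  define c where "c s p = (if s = 1 then p else (snd p, fst p))" for s :: 3 and p :: "'a \<times> 'a"
  have c: "arc (c s p) v = s * arc p v" if "s \<in> {1, -1}" for s p v
    using that by (auto simp: c_def arc_def)
  have ends: "{fst (c s p), snd (c s p)} = {fst p, snd p}" for s p
    by (auto simp: c_def)
  have ne: "x1 \<noteq> x2" "x2 \<noteq> x1" "x1 \<noteq> x3" "x3 \<noteq> x1" "x2 \<noteq> x3" "x3 \<noteq> x2"
    using assms(1) by auto
  have "g = 0 + arc (c s3 (x3, x1)) + arc (c s2 (x2, x3)) + arc (c s1 (x1, x2))"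
  proof
    fix v
    have "g v = s3 * dipole x3 x1 v + s2 * dipole x2 x3 v + s1 * dipole x1 x2 v"
    proof (cases "v \<in> {x1, x2, x3}")
      case True
      then show ?thesis
        using ne by (elim insertE emptyE) (simp_all add: arc_def s(4,5) g3)
    qed (simp add: g0 arc_def)
    then show "g v = (0 + arc (c s3 (x3, x1)) + arc (c s2 (x2, x3)) + arc (c s1 (x1, x2))) v"
      by (simp add: c[OF s(1)] c[OF s(2)] c[OF s(3)])
  qed
  moreover have "realizable en {e1, e2, e3} (0 + arc (c s3 (x3, x1)) + arc (c s2 (x2, x3)) + arc (c s1 (x1, x2)))"
    by (rule r) (auto simp: ends)
  ultimately show ?thesis by metis
qed

lemma ear_realizable:
  assumes "finite E" "e1 \<notin> E" "e2 \<notin> E" "e1 \<noteq> e2" "en e1 = {x, y}" "en e2 = {x, z}"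
    "realizable en E g"
  shows "realizable en (insert e1 (insert e2 E)) (g + dipole y z)"
    and "realizable en (insert e1 (insert e2 E)) (g + dipole y x + dipole z x)"
    and "realizable en (insert e1 (insert e2 E)) (g + dipole x y + dipole x z)"
proof -
  have r: "realizable en (insert e1 (insert e2 E)) (g + dipole c d + dipole a b)"
    if "{a, b} = {x, y}" "{c, d} = {x, z}" for a b c d
    using assms that by (intro realizable_insert) auto
  show "realizable en (insert e1 (insert e2 E)) (g + dipole y z)"
    using r[of y x x z] by (simp add: arc_def plus_fun_def insert_commute)
  show "realizable en (insert e1 (insert e2 E)) (g + dipole y x + dipole z x)"
    using r[of y x z x] by (simp add: insert_commute algebra_simps)
  show "realizable en (insert e1 (insert e2 E)) (g + dipole x y + dipole x z)"
    using r[of x y x z] by (simp add: algebra_simps)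
qed

text \<open>An ear used as a directed path through \<open>x\<close> adds a dipole between
  \<open>y\<close> and \<open>z\<close> in either direction, so the smaller tree has to realize
  \<open>g\<close> plus or minus that dipole. If it realizes \<open>g\<close> itself, reversing the
  edge \<open>e\<close> between \<open>y\<close> and \<open>z\<close> leads to one of these
  two.\<close>

lemma ear_realizable_zero:
  assumes "ttree en V E" "x \<notin> V" "e \<in> E" "en e = {y, z}"
    "e1 \<noteq> e2" "e1 \<notin> E" "e2 \<notin> E" "en e1 = {x, y}" "en e2 = {x, z}"
    and three: "realizable en E g \<or> realizable en E (g + dipole y z) \<or> realizable en E (g - dipole y z)"
  shows "realizable en (insert e1 (insert e2 E)) g"
proof -
  have fin: "finite E" using assms(1) ttree_finite by blast
  have "realizable en E (g + dipole y z) \<or> realizable en E (g - dipole y z)"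
    using three realizable_flip[of E e en y z g] fin assms(3,4) by blast
  then show ?thesis
  proof
    assume "realizable en E (g + dipole y z)"
    from ear_realizable(1)[of E e2 e1 en x z y, OF fin _ _ _ _ _ this] assms
    show ?thesis by (auto simp: dipole_swap[of z y] insert_commute)
  next
    assume "realizable en E (g - dipole y z)"
    from ear_realizable(1)[of E e1 e2 en x y z, OF fin _ _ _ _ _ this] assms
    show ?thesis by auto
  qed
qed

definition tri :: "'v set \<Rightarrow> 'v \<Rightarrow> 3" where
  "tri t v = of_bool (v \<in> t)"

text \<open>Both ear edges point into \<open>x\<close> if \<open>g x = 1\<close> and out of
  \<open>x\<close> if \<open>g x = -1\<close>. Two arcs into \<open>x\<close> contribute -2 = 1 at
  \<open>x\<close> and 1 at \<open>y\<close> and at \<open>z\<close>: this is the origin of the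
  triangle indicators.\<close>

lemma ear_realizable_nonzero:
  assumes "ttree en V E" "x \<notin> V" "e \<in> E" "en e = {y, z}" "y \<noteq> z"
    "e1 \<noteq> e2" "e1 \<notin> E" "e2 \<notin> E" "en e1 = {x, y}" "en e2 = {x, z}"
    "g x \<noteq> 0" "realizable en E (g - (\<lambda>v. g x * tri {x, y, z} v))"
  shows "realizable en (insert e1 (insert e2 E)) g"
proof -
  have fin: "finite E" and yz: "y \<in> V" "z \<in> V"
    using ttree_finite[OF assms(1)] assms(3,4) by auto
  have xyz: "x \<noteq> y" "x \<noteq> z" using yz assms(2) by auto
  note ear = ear_realizable[OF fin assms(7,8,6,9,10,12)]
  show ?thesis
  proof (cases "g x" rule: three_cases)
    case 2
    have "g - (\<lambda>v. g x * tri {x, y, z} v) + dipole y x + dipole z x = g"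
      using xyz assms(5) 2 by (auto simp: fun_eq_iff arc_def tri_def)
    then show ?thesis using ear(2) by metis
  next
    case 3
    have "g - (\<lambda>v. g x * tri {x, y, z} v) + dipole x y + dipole x z = g"
      using xyz assms(5) 3 by (auto simp: fun_eq_iff arc_def tri_def)
    then show ?thesis using ear(3) by metis
  qed (use assms in auto)
qed

lemma zero_sum_ear:
  assumes "finite V" "x \<notin> V" "y \<in> V" "z \<in> V" "y \<noteq> z" "zero_sum (insert x V) g"
  shows "zero_sum V (g - (\<lambda>v. g x * tri {x, y, z} v))"
proof -
  have "(\<Sum>v\<in>V. tri {x, y, z} v) = (\<Sum>v\<in>V. of_bool (v = y) + of_bool (v = z))"
    using assms(2,5) by (intro sum.cong) (auto simp: tri_def)
  also have "\<dots> = -1" using assms(1,3,4) by (simp add: sum.distrib)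
  finally have "(\<Sum>v\<in>V. tri {x, y, z} v) = -1" .
  then have "(\<Sum>v\<in>V. (g - (\<lambda>v. g x * tri {x, y, z} v)) v) = 0"
    using assms(1,2,6) by (simp add: sum_subtractf zero_sum_def sum_distrib_left[symmetric] add.commute)
  then show ?thesis using assms(2-4,6) by (auto simp: zero_sum_def tri_def)
qed

text \<open>The unrealizable boundaries contain no affine line over Z/3. On a triangle there are
  only two of them, too few for a line. At an ear, either some point of the line vanishes at
  \<open>x\<close>, or \<open>d\<close> vanishes at \<open>x\<close> and subtracting the forced
  triangle multiple leaves a line with the same direction on the smaller tree.\<close>

lemma ttree_realizable_one_of_three:
  assumes "ttree en V E" "zero_sum V g" "zero_sum V d" "d \<noteq> 0"
  shows "realizable en E g \<or> realizable en E (g + d) \<or> realizable en E (g - d)"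
  using assms
proof (induction arbitrary: g d rule: ttree.induct)
  case (base x1 x2 x3 e1 e2 e3)
  have d: "d x1 \<noteq> 0 \<or> d x2 \<noteq> 0"
    using base(1,7,8) by (auto simp: zero_sum_def fun_eq_iff)
  have six: "c = 0 \<or> c \<noteq> b \<or> c + s = 0 \<or> c + s \<noteq> b + t \<or> c - s = 0 \<or> c - s \<noteq> b - t"
    if "s \<noteq> 0 \<or> t \<noteq> 0" for b c s t :: 3
    using that by (cases c rule: three_cases; cases s rule: three_cases) auto
  from six[OF d, of "g x1" "g x2"]
  consider "g x1 = 0 \<or> g x1 \<noteq> g x2"
    | "(g + d) x1 = 0 \<or> (g + d) x1 \<noteq> (g + d) x2"
    | "(g - d) x1 = 0 \<or> (g - d) x1 \<noteq> (g - d) x2"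
    unfolding plus_fun_apply fun_diff_def by blast
  then show ?case
  proof cases
    case 1
    then show ?thesis using realizable_triangle[OF base(1-6)] by simp
  next
    case 2
    then show ?thesis using realizable_triangle[OF base(1-5) zero_sum_add[OF base(6,7)]] by blast
  next
    case 3
    then show ?thesis using realizable_triangle[OF base(1-5) zero_sum_diff[OF base(6,7)]] by blast
  qed
next
  case (ear V E x e y z e1 e2)
  have fin: "finite V" "finite E" and yz: "y \<in> V" "z \<in> V"
    using ttree_finite[OF ear(1)] ear(3,4) by auto
  \<comment> \<open>The induction hypothesis is applied here to the line in direction
    \<open>dipole y z\<close>, not \<open>d\<close>; it provides the three alternatives of
    \<open>ear_realizable_zero\<close>.\<close>
  have Z: "realizable en (insert e1 (insert e2 E)) h"
    if "zero_sum (insert x V) h" "h x = 0" for h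
  proof (rule ear_realizable_zero[OF ear(1-4) ear(6-10)])
    have "dipole y z \<noteq> 0" using \<open>y \<noteq> z\<close> by (auto simp: arc_def fun_eq_iff)
    then show "realizable en E h \<or> realizable en E (h + dipole y z) \<or> realizable en E (h - dipole y z)"
      using ear.IH[of h "dipole y z"] zero_sum_remove[OF fin(1) ear(2) that]
        zero_sum_arc[of V "(y, z)"] yz fin
      by (metis fst_conv snd_conv)
  qed
  show ?case
  proof (cases "g x = 0 \<or> d x \<noteq> 0")
    case True
    have "g x = 0 \<or> (g + d) x = 0 \<or> (g - d) x = 0"
      using True by (cases "g x" rule: three_cases; cases "d x" rule: three_cases) auto
    then show ?thesis
      using Z zero_sum_add[OF ear.prems(1,2)] zero_sum_diff[OF ear.prems(1,2)] ear.prems(1) by blast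
  next
    case False
    let ?t = "\<lambda>v. g x * tri {x, y, z} v"
    have three: "realizable en E (g - ?t) \<or> realizable en E (g - ?t + d) \<or> realizable en E (g - ?t - d)"
    proof (rule ear.IH)
      show "zero_sum V (g - ?t)"
        by (rule zero_sum_ear[OF fin(1) ear(2) yz ear(5) ear.prems(1)])
      show "zero_sum V d"
        using zero_sum_remove[OF fin(1) ear(2) ear.prems(2)] False by blast
    qed (rule ear.prems(3))
    have lift: "realizable en (insert e1 (insert e2 E)) h"
      if "h x = g x" "realizable en E (h - ?t)" for h
      using ear_realizable_nonzero[where g = h, OF ear(1-10)] False that by simp
    have eq: "g - ?t + d = (g + d) - ?t" "g - ?t - d = (g - d) - ?t"
      by (simp_all add: fun_eq_iff)
    have "(g + d) x = g x" "(g - d) x = g x" using False by simp_all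
    then show ?thesis
      using three[unfolded eq] lift[of g] lift[of "g + d"] lift[of "g - d"] by blast
  qed
qed

text \<open>Read contrapositively: an unrealizable boundary is nonzero at the newest vertex. This
  will be the nonzero coefficient of the newest triangle.\<close>

lemma ttree_ear_realizable:
  assumes "ttree en V E" "x \<notin> V" "e \<in> E" "en e = {y, z}" "y \<noteq> z"
    "e1 \<noteq> e2" "e1 \<notin> E" "e2 \<notin> E" "en e1 = {x, y}" "en e2 = {x, z}"
    "zero_sum (insert x V) g" "g x = 0"
  shows "realizable en (insert e1 (insert e2 E)) g"
proof (rule ear_realizable_zero[OF assms(1-4,6-10)])
  have fin: "finite V" "finite E" and yz: "y \<in> V" "z \<in> V"
    using ttree_finite[OF assms(1)] assms(3,4) by auto
  have "dipole y z \<noteq> 0" using \<open>y \<noteq> z\<close> by (auto simp: arc_def fun_eq_iff)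
  then show "realizable en E g \<or> realizable en E (g + dipole y z) \<or> realizable en E (g - dipole y z)"
    using zero_sum_remove[OF fin(1) assms(2,11,12)] zero_sum_arc[of V "(y, z)"] yz fin
    by (intro ttree_realizable_one_of_three[OF assms(1)]) auto
qed

section \<open>Triangle coordinates of the unrealizable boundaries\<close>

text \<open>\<open>TT\<close> is meant to hold the vertex sets of the triangles of the construction:
  the first one and one per ear, hence \<open>card V - 2\<close>. The independence clause makes the
  coefficients of a boundary well defined.\<close>

definition unrealizable_basis :: "('e \<Rightarrow> 'v set) \<Rightarrow> 'v set \<Rightarrow> 'e set \<Rightarrow> 'v set set \<Rightarrow> bool" where
  "unrealizable_basis en V E TT \<longleftrightarrow>
    finite TT \<and> card TT = card V - 2 \<and> (\<forall>t\<in>TT. t \<subseteq> V \<and> card t = 3) \<and>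
    (\<forall>c. (\<Sum>t\<in>TT. (\<lambda>v. c t * tri t v)) = 0 \<longrightarrow> (\<forall>t\<in>TT. c t = 0)) \<and>
    (\<forall>g. zero_sum V g \<longrightarrow> \<not> realizable en E g \<longrightarrow>
      (\<exists>c. (\<forall>t\<in>TT. c t \<noteq> 0) \<and> g = (\<Sum>t\<in>TT. (\<lambda>v. c t * tri t v))))"

lemma unrealizable_basisI:
  assumes "finite TT" "card TT = card V - 2" "\<And>t. t \<in> TT \<Longrightarrow> t \<subseteq> V \<and> card t = 3"
    and "\<And>c t. (\<Sum>t\<in>TT. (\<lambda>v. c t * tri t v)) = 0 \<Longrightarrow> t \<in> TT \<Longrightarrow> c t = 0"
    and "\<And>g. zero_sum V g \<Longrightarrow> \<not> realizable en E g \<Longrightarrow>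
      \<exists>c. (\<forall>t\<in>TT. c t \<noteq> 0) \<and> g = (\<Sum>t\<in>TT. (\<lambda>v. c t * tri t v))"
  shows "unrealizable_basis en V E TT"
  unfolding unrealizable_basis_def
proof (intro conjI)
  show "\<forall>c. (\<Sum>t\<in>TT. (\<lambda>v. c t * tri t v)) = 0 \<longrightarrow> (\<forall>t\<in>TT. c t = 0)"
    by (intro allI impI ballI) (rule assms(4))
  show "\<forall>g. zero_sum V g \<longrightarrow> \<not> realizable en E g \<longrightarrow>
      (\<exists>c. (\<forall>t\<in>TT. c t \<noteq> 0) \<and> g = (\<Sum>t\<in>TT. (\<lambda>v. c t * tri t v)))"
    by (intro allI impI) (rule assms(5))
  show "\<forall>t\<in>TT. t \<subseteq> V \<and> card t = 3" by (rule ballI) (rule assms(3))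
qed (fact assms(1,2))+

lemma unrealizable_basisD:
  assumes "unrealizable_basis en V E TT"
  shows "finite TT" "card TT = card V - 2" "\<forall>t\<in>TT. t \<subseteq> V \<and> card t = 3"
    and "(\<Sum>t\<in>TT. (\<lambda>v. c t * tri t v)) = 0 \<Longrightarrow> \<forall>t\<in>TT. c t = 0"
    and "zero_sum V g \<Longrightarrow> \<not> realizable en E g \<Longrightarrow>
      \<exists>c. (\<forall>t\<in>TT. c t \<noteq> 0) \<and> g = (\<Sum>t\<in>TT. (\<lambda>v. c t * tri t v))"
proof -
  note a = assms[unfolded unrealizable_basis_def]
  show "finite TT" "card TT = card V - 2" "\<forall>t\<in>TT. t \<subseteq> V \<and> card t = 3"
    by (rule a[THEN conjunct1], rule a[THEN conjunct2, THEN conjunct1],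
        rule a[THEN conjunct2, THEN conjunct2, THEN conjunct1])
  show "\<forall>t\<in>TT. c t = 0" if "(\<Sum>t\<in>TT. (\<lambda>v. c t * tri t v)) = 0"
    using a[THEN conjunct2, THEN conjunct2, THEN conjunct2, THEN conjunct1, THEN spec[of _ c]] that
    by (rule mp)
  show "\<exists>c. (\<forall>t\<in>TT. c t \<noteq> 0) \<and> g = (\<Sum>t\<in>TT. (\<lambda>v. c t * tri t v))"
    if "zero_sum V g" "\<not> realizable en E g"
    using a[THEN conjunct2, THEN conjunct2, THEN conjunct2, THEN conjunct2, THEN spec[of _ g]] that
    by (rule mp[OF mp])
qed

text \<open>The new triangle is the only one containing \<open>x\<close>. This gives independence,
  and it forces the new coefficient of an unrealizable \<open>g\<close> to be \<open>g x\<close>,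
  which is nonzero. What remains after subtracting that multiple is unrealizable on the smaller
  tree, so its coefficients are nonzero by induction.\<close>

lemma ttree_unrealizable:
  fixes V :: "'v set"
  assumes "ttree en V E"
  shows "\<exists>TT. unrealizable_basis en V E TT"
  using assms
proof (induction rule: ttree.induct)
  case (base x1 x2 x3 e1 e2 e3)
  let ?t = "{x1, x2, x3}"
  have bad: "\<exists>c. (\<forall>t\<in>{?t}. c t \<noteq> 0) \<and> g = (\<Sum>t\<in>{?t}. (\<lambda>v. c t * tri t v))"
    if g: "zero_sum ?t g" "\<not> realizable en {e1, e2, e3} g" for g
  proof -
    have "\<not> (g x1 = 0 \<or> g x1 \<noteq> g x2)"
      using realizable_triangle[OF base g(1)] g(2) by blast
    then have eq: "g x1 \<noteq> 0" "g x2 = g x1" by auto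
    moreover have "g x3 + (g x1 + g x2) = 0"
      using base(1) g(1) by (simp add: zero_sum_def add_ac)
    then have "g x3 = g x1"
      using eq by simp
    ultimately have "g = (\<lambda>v. g x1 * tri ?t v)"
      using g(1) by (auto simp: fun_eq_iff zero_sum_def tri_def)
    then show ?thesis using eq by (intro exI[of _ "\<lambda>_. g x1"]) auto
  qed
  have "unrealizable_basis en ?t {e1, e2, e3} {?t}"
  proof (rule unrealizable_basisI)
    show "c t = 0" if "(\<Sum>t\<in>{?t}. (\<lambda>v. c t * tri t v)) = 0" "t \<in> {?t}" for c t
    proof -
      have "c t * tri t x1 = 0" "t = ?t" using that by (simp_all add: fun_eq_iff)
      then show ?thesis by (simp add: tri_def)
    qed
    show "card {?t} = card ?t - 2" "finite {?t}" using base(1) by simp_all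
    show "t \<subseteq> ?t \<and> card t = 3" if "t \<in> {?t}" for t
      using that base(1) by simp
  qed (rule bad)
  then show ?case by blast
next
  case (ear V E x e y z e1 e2)
  have fin: "finite V" "finite E" and yz: "y \<in> V" "z \<in> V" and "3 \<le> card V"
    using ttree_finite[OF ear(1)] ear(3,4) by (blast, blast, force, force, blast)
  obtain TT where B: "unrealizable_basis en V E TT" using ear.IH by blast
  note TT = unrealizable_basisD(1-3)[OF B]
  note ind = unrealizable_basisD(4)[OF B] and bad = unrealizable_basisD(5)[OF B]
  let ?t = "{x, y, z}"
  have new: "?t \<notin> TT" using TT(3) ear(2) by auto
  have x0: "(\<Sum>t\<in>TT. c t * tri t x) = 0" for c
    using TT(3) ear(2) by (intro sum.neutral) (auto simp: tri_def)
  have ind': "\<forall>t\<in>insert ?t TT. c t = 0" if c: "(\<Sum>t\<in>insert ?t TT. (\<lambda>v. c t * tri t v)) = 0" for c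
  proof -
    have "(\<Sum>t\<in>insert ?t TT. (\<lambda>v. c t * tri t v)) x = 0" using c by simp
    then have "c ?t = 0"
      using TT(1) new x0[of c] by (simp add: sum_fun_apply) (simp add: tri_def)
    moreover have "(\<Sum>t\<in>TT. (\<lambda>v. c t * tri t v)) = 0"
      using c TT(1) new \<open>c ?t = 0\<close> by (simp add: fun_eq_iff)
    ultimately show ?thesis using ind by blast
  qed
  have bad': "\<exists>c. (\<forall>t\<in>insert ?t TT. c t \<noteq> 0) \<and> g = (\<Sum>t\<in>insert ?t TT. (\<lambda>v. c t * tri t v))"
    if g: "zero_sum (insert x V) g" "\<not> realizable en (insert e1 (insert e2 E)) g" for g
  proof -
    have gx: "g x \<noteq> 0"
      using ttree_ear_realizable[where g = g, OF ear(1-10) g(1)] g(2) by auto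
    let ?h = "g - (\<lambda>v. g x * tri ?t v)"
    have h: "\<not> realizable en E ?h"
      using ear_realizable_nonzero[where g = g, OF ear(1-10) gx] g(2) by auto
    obtain c where c: "\<forall>t\<in>TT. c t \<noteq> 0" "?h = (\<Sum>t\<in>TT. (\<lambda>v. c t * tri t v))"
      by (rule exE[OF bad[of ?h, OF zero_sum_ear[OF fin(1) ear(2) yz ear(5) g(1)] h]], elim conjE)
    let ?c = "c(?t := g x)"
    have "(\<Sum>t\<in>TT. (\<lambda>v. ?c t * tri t v)) = (\<Sum>t\<in>TT. (\<lambda>v. c t * tri t v))"
      using new by (intro sum.cong) auto
    then have "(\<Sum>t\<in>insert ?t TT. (\<lambda>v. ?c t * tri t v)) = (\<lambda>v. g x * tri ?t v) + ?h"
      using TT(1) new c(2) by simp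
    then have "g = (\<Sum>t\<in>insert ?t TT. (\<lambda>v. ?c t * tri t v))" by simp
    then show ?thesis using c(1) gx by (intro exI[of _ ?c]) auto
  qed
  have t: "?t \<subseteq> insert x V" using yz by blast
  have "x \<noteq> y" "x \<noteq> z" using ear(2) yz by blast+
  then have t3: "card ?t = 3" using ear(5) by simp
  have "unrealizable_basis en (insert x V) (insert e1 (insert e2 E)) (insert ?t TT)"
  proof (rule unrealizable_basisI)
    show "card (insert ?t TT) = card (insert x V) - 2"
      using TT(1,2) new fin(1) ear(2) \<open>3 \<le> card V\<close> by simp
    show "t \<subseteq> insert x V \<and> card t = 3" if "t \<in> insert ?t TT" for t
      using that t t3 TT(3) by blast
    show "c t = 0" if "(\<Sum>t\<in>insert ?t TT. (\<lambda>v. c t * tri t v)) = 0" "t \<in> insert ?t TT" for c t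
      using ind'[OF that(1)] that(2) by (rule bspec)
    show "finite (insert ?t TT)" using TT(1) by simp
  qed (rule bad')
  then show ?case by blast
qed

text \<open>A single term would have to be nonzero at both \<open>y\<close> and \<open>z\<close>,
  hence equal there, but the dipole is 1 at one and -1 at the other.\<close>

lemma dipole_tri_support:
  assumes "y \<noteq> z" "finite TT" "\<forall>t\<in>TT. card t = 3" "dipole y z = (\<Sum>t\<in>TT. (\<lambda>v. c t * tri t v))"
  shows "2 \<le> card {t \<in> TT. c t \<noteq> 0}"
proof (rule ccontr)
  let ?S = "{t \<in> TT. c t \<noteq> 0}"
  assume "\<not> 2 \<le> card ?S"
  moreover have "finite ?S" using assms(2) by simp
  moreover have "card ?S = 0 \<or> card ?S = Suc 0"
    using \<open>\<not> 2 \<le> card ?S\<close> by linarith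
  ultimately have S: "?S = {} \<or> (\<exists>t. ?S = {t})"
    unfolding card_1_singleton_iff by (auto simp: card_eq_0_iff)
  have eq: "dipole y z = (\<Sum>t\<in>?S. (\<lambda>v. c t * tri t v))"
    unfolding assms(4) using assms(2) by (intro sum.mono_neutral_right) (auto simp: fun_eq_iff)
  have "dipole y z y \<noteq> 0" using assms(1) by (simp add: arc_def)
  then have "?S \<noteq> {}" using eq by (metis sum.empty zero_fun_apply)
  with S obtain t where t: "?S = {t}" by blast
  have d: "dipole y z v = c t * tri t v" for v using eq unfolding t by simp
  have "tri t y \<noteq> 0" "tri t z \<noteq> 0"
    using d[of y] d[of z] assms(1) by (auto simp: arc_def)
  then have "y \<in> t" "z \<in> t" by (auto simp: tri_def)
  then show False
    using d[of y] d[of z] assms(1) by (simp add: tri_def arc_def)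
qed

lemma unrealizable_dipoles_bound:
  assumes T: "ttree en V E" and "finite I"
    and d: "\<And>i. i \<in> I \<Longrightarrow> \<exists>y\<in>V. \<exists>z\<in>V. y \<noteq> z \<and> d i = dipole y z"
    and g: "zero_sum V g"
    and bad: "\<And>J. J \<subseteq> I \<Longrightarrow> \<not> realizable en E (g + (\<Sum>i\<in>J. d i))"
  shows "2 * card I \<le> card V - 2"
proof -
  obtain TT where B: "unrealizable_basis en V E TT" using ttree_unrealizable[OF T] by blast
  note TT = unrealizable_basisD(1-3)[OF B]
  note ind = unrealizable_basisD(4)[OF B] and span = unrealizable_basisD(5)[OF B]
  have dz: "zero_sum V (d i)" if "i \<in> I" for i
  proof -
    obtain y z where "y \<in> V" "z \<in> V" "d i = dipole y z" using d[OF \<open>i \<in> I\<close>] by blast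
    then show ?thesis using zero_sum_arc[of V "(y, z)"] ttree_finite[OF T] by simp
  qed
  define L where "L c = (\<Sum>t\<in>TT. (\<lambda>v. c t * tri t v))" for c
  have L_diff: "L c - L c' = L (\<lambda>t. c t - c' t)" for c c'
    unfolding L_def by (simp add: fun_eq_iff sum_fun_apply left_diff_distrib sum_subtractf)
  have coeff: "\<exists>c. (\<forall>t\<in>TT. c t \<noteq> 0) \<and> g + (\<Sum>i\<in>J. d i) = L c" if "J \<subseteq> I" for J
    unfolding L_def
  proof (rule span)
    show "zero_sum V (g + (\<Sum>i\<in>J. d i))"
      by (rule zero_sum_add[OF g], rule zero_sum_sum) (use that dz in blast)
  qed (rule bad[OF that])
  \<comment> \<open>\<open>C J\<close> holds the triangle coordinates after the shifts in
    \<open>J\<close>; \<open>c i\<close> below is the change caused by shift \<open>i\<close>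
    alone.\<close>
  define C where "C J = (SOME c. (\<forall>t\<in>TT. c t \<noteq> 0) \<and> g + (\<Sum>i\<in>J. d i) = L c)" for J
  have "(\<forall>t\<in>TT. C J t \<noteq> 0) \<and> g + (\<Sum>i\<in>J. d i) = L (C J)" if "J \<subseteq> I" for J
    unfolding C_def by (rule someI_ex[OF coeff[OF that]])
  then have C: "t \<in> TT \<Longrightarrow> C J t \<noteq> 0" "g + (\<Sum>i\<in>J. d i) = L (C J)" if "J \<subseteq> I" for J t
    using that by blast+
  define c where "c i t = C {i} t - C {} t" for i t
  have L0: "g = L (C {})" using C(2)[of "{}"] by simp
  have L1: "g + d i = L (C {i})" if "i \<in> I" for i using C(2)[of "{i}"] that by simp
  have di: "d i = L (c i)" if "i \<in> I" for i
  proof -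
    have "d i = (g + d i) - g" by simp
    also have "\<dots> = L (C {i}) - L (C {})" using L1[OF that] L0 by metis
    finally show ?thesis unfolding L_diff c_def .
  qed
  \<comment> \<open>Linear independence turns additivity of the shifts into additivity of their
    coordinates.\<close>
  have Cij: "C {i, j} t = C {} t + c i t + c j t" if "i \<in> I" "j \<in> I" "i \<noteq> j" "t \<in> TT" for i j t
  proof -
    have "g + (d i + d j) = L (C {i, j})" using C(2)[of "{i, j}"] that(1-3) by simp
    moreover have "g + (d i + d j) - g - d i - d j = 0" by simp
    ultimately have "L (C {i, j}) - L (C {}) - L (c i) - L (c j) = 0"
      using L0 di[OF that(1)] di[OF that(2)] by metis
    then have "L (\<lambda>t. C {i, j} t - C {} t - c i t - c j t) = 0" unfolding L_diff .
    then have "C {i, j} t - C {} t - c i t - c j t = 0"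
      using ind[of "\<lambda>t. C {i, j} t - C {} t - c i t - c j t"] that(4) unfolding L_def by blast
    then show ?thesis by (simp only: diff_eq_eq diff_0 add_0 add.assoc) (simp add: add_ac)
  qed
  define S where "S i = {t \<in> TT. c i t \<noteq> 0}" for i
  have disj: "S i \<inter> S j = {}" if "i \<in> I" "j \<in> I" "i \<noteq> j" for i j
  proof (rule ccontr)
    assume "S i \<inter> S j \<noteq> {}"
    then obtain t where t: "t \<in> TT" "c i t \<noteq> 0" "c j t \<noteq> 0" by (auto simp: S_def)
    have "C {} t \<noteq> 0" "C {} t + c i t \<noteq> 0" "C {} t + c j t \<noteq> 0"
      using C(1)[of "{}" t] C(1)[of "{i}" t] C(1)[of "{j}" t] that t(1) by (simp_all add: c_def)
    moreover have "C {} t + c i t + c j t \<noteq> 0"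
      using C(1)[of "{i, j}" t] Cij[OF that t(1)] that t(1) by simp
    \<comment> \<open>For nonzero \<open>q\<close> and \<open>r\<close> the four values 0,
      \<open>q\<close>, \<open>r\<close>, \<open>q + r\<close> exhaust the residues modulo 3, so one
      of them is \<open>- p\<close>.\<close>
    moreover have "p = 0 \<or> p + q = 0 \<or> p + r = 0 \<or> p + q + r = 0" if "q \<noteq> 0" "r \<noteq> 0" for p q r :: 3
      using that by (cases p rule: three_cases; cases q rule: three_cases; cases r rule: three_cases) simp_all
    ultimately show False using t(2,3) by blast
  qed
  have "2 * card I = (\<Sum>i\<in>I. 2)" by simp
  also have "\<dots> \<le> (\<Sum>i\<in>I. card (S i))"
  proof (rule sum_mono)
    fix i assume "i \<in> I"
    then obtain y z where "y \<noteq> z" "d i = dipole y z" using d by blast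
    then show "2 \<le> card (S i)"
      unfolding S_def using dipole_tri_support[of y z TT "c i"] TT(1,3) di[OF \<open>i \<in> I\<close>] unfolding L_def
      by simp
  qed
  also have "\<dots> = card (\<Union>i\<in>I. S i)"
    using assms(2) disj TT(1) by (intro card_UN_disjoint[symmetric]) (auto simp: S_def)
  also have "\<dots> \<le> card TT" using TT(1) by (intro card_mono) (auto simp: S_def)
  finally show ?thesis using TT(2) by simp
qed

section \<open>Strong orientations\<close>

text \<open>Strong connectivity through cuts rather than directed paths, as the circulation theorem
  consumes it. \<open>X\<close> is not confined to \<open>V\<close>, so a cut of an enlarged vertex
  set serves unchanged as a cut of the old one.\<close>

definition strong :: "'v set \<Rightarrow> 'e set \<Rightarrow> ('e \<Rightarrow> 'v \<times> 'v) \<Rightarrow> bool" where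
  "strong V E p \<longleftrightarrow>
    (\<forall>X. X \<inter> V \<noteq> {} \<longrightarrow> V - X \<noteq> {} \<longrightarrow> (\<exists>e\<in>E. fst (p e) \<in> X \<and> snd (p e) \<notin> X))"

definition strongly_realizable :: "('e \<Rightarrow> 'v set) \<Rightarrow> 'v set \<Rightarrow> 'e set \<Rightarrow> ('v \<Rightarrow> 3) \<Rightarrow> bool" where
  "strongly_realizable en V E g \<longleftrightarrow>
    (\<exists>p. orients en E p \<and> strong V E p \<and> (\<Sum>e\<in>E. arc (p e)) = g)"

lemma strong_mono: "strong V E p \<Longrightarrow> E \<subseteq> F \<Longrightarrow> strong V F p"
  unfolding strong_def by blast

lemma strong_cong: "(\<And>e. e \<in> E \<Longrightarrow> p e = q e) \<Longrightarrow> strong V E p \<Longrightarrow> strong V E q"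
  unfolding strong_def by (metis (no_types, lifting))

lemma strongly_realizable_imp: "strongly_realizable en V E g \<Longrightarrow> realizable en E g"
  unfolding strongly_realizable_def realizable_def by blast

lemma strongly_realizable_zero_sum:
  assumes "strongly_realizable en V E g" "finite V" "\<forall>e\<in>E. en e \<subseteq> V"
  shows "zero_sum V g"
proof -
  obtain p where p: "orients en E p" "(\<Sum>e\<in>E. arc (p e)) = g"
    using assms(1) unfolding strongly_realizable_def by blast
  have "zero_sum V (\<Sum>e\<in>E. arc (p e))"
  proof (rule zero_sum_sum)
    fix e assume "e \<in> E"
    then show "zero_sum V (arc (p e))"
      using p(1) assms(2,3) by (intro zero_sum_arc) (auto simp: orients_def)
  qed
  then show ?thesis unfolding p(2) .
qed

lemma strongly_realizable_union:
  assumes "finite E" "finite F" "E \<inter> F = {}" "strongly_realizable en V E g" "realizable en F h"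
  shows "strongly_realizable en V (E \<union> F) (g + h)"
proof -
  obtain p where p: "orients en E p" "strong V E p" "(\<Sum>e\<in>E. arc (p e)) = g"
    using assms(4) unfolding strongly_realizable_def by blast
  obtain q where q: "orients en F q" "(\<Sum>e\<in>F. arc (q e)) = h"
    using assms(5) unfolding realizable_def by blast
  define r where "r e = (if e \<in> E then p e else q e)" for e
  have "strong V (E \<union> F) r"
    by (rule strong_mono[of _ E], rule strong_cong[OF _ p(2)]) (auto simp: r_def)
  moreover have "orients en (E \<union> F) r"
    using p(1) q(1) by (auto simp: orients_def r_def)
  moreover have "(\<Sum>e\<in>E. arc (r e)) = (\<Sum>e\<in>E. arc (p e))"
    by (rule sum.cong) (auto simp: r_def)
  moreover have "(\<Sum>e\<in>F. arc (r e)) = (\<Sum>e\<in>F. arc (q e))"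
    using assms(3) by (intro sum.cong) (auto simp: r_def)
  ultimately show ?thesis
    using sum.union_disjoint[OF assms(1-3), of "\<lambda>e. arc (r e)"] p(3) q(2)
    unfolding strongly_realizable_def by metis
qed

lemma strongly_realizable_insert:
  assumes "finite E" "e \<notin> E" "en e = {y, z}" "strongly_realizable en V E g"
  shows "strongly_realizable en V (insert e E) (g + dipole y z)"
proof -
  have "realizable en {e} (dipole y z)"
    using realizable_insert[of "{}" e en y z 0] realizable_empty[of en] assms(3) by simp
  then show ?thesis
    using strongly_realizable_union[of E "{e}" en V g "dipole y z"] assms by simp
qed

text \<open>A set that splits \<open>V\<close> is already left by an edge of \<open>E\<close>. Any
  other cut separates \<open>x\<close> from all of \<open>V\<close>, and one of the two arcs of the
  path through \<open>x\<close> leaves it.\<close>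

lemma strong_ear:
  assumes "strong V E p" "fst (p e1) = y" "snd (p e1) = x" "fst (p e2) = x" "snd (p e2) = z"
    "y \<in> V" "z \<in> V" "x \<notin> V"
  shows "strong (insert x V) (insert e1 (insert e2 E)) p"
  unfolding strong_def
proof (intro allI impI)
  fix X assume X: "X \<inter> insert x V \<noteq> {}" "insert x V - X \<noteq> {}"
  show "\<exists>e\<in>insert e1 (insert e2 E). fst (p e) \<in> X \<and> snd (p e) \<notin> X"
  proof (cases "X \<inter> V \<noteq> {} \<and> V - X \<noteq> {}")
    case True
    then show ?thesis using assms(1) unfolding strong_def by blast
  next
    case False
    then show ?thesis using X assms(2-8) by (cases "x \<in> X") auto
  qed
qed

lemma strongly_realizable_ear:
  assumes "finite E" "e1 \<notin> E" "e2 \<notin> E" "e1 \<noteq> e2" "en e1 = {x, y}" "en e2 = {x, z}"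
    "y \<in> V" "z \<in> V" "x \<notin> V" "strongly_realizable en V E g"
  shows "strongly_realizable en (insert x V) (insert e1 (insert e2 E)) (g + dipole y z)"
proof -
  obtain p where p: "orients en E p" "strong V E p" "(\<Sum>e\<in>E. arc (p e)) = g"
    using assms(10) unfolding strongly_realizable_def by blast
  define q where "q = p(e1 := (y, x), e2 := (x, z))"
  have eq: "q e = p e" if "e \<in> E" for e using that assms(2,3) by (auto simp: q_def)
  have "strong V E q" by (rule strong_cong[OF _ p(2)]) (simp add: eq)
  then have "strong (insert x V) (insert e1 (insert e2 E)) q"
    using assms(4,7-9) by (rule_tac strong_ear[where y = y and z = z]) (auto simp: q_def)
  moreover have "orients en (insert e1 (insert e2 E)) q"
    using p(1) assms(4-6) eq by (auto simp: orients_def q_def)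
  moreover have "(\<Sum>e\<in>E. arc (q e)) = (\<Sum>e\<in>E. arc (p e))"
    by (rule sum.cong) (simp_all add: eq)
  then have "(\<Sum>e\<in>insert e1 (insert e2 E). arc (q e)) = arc (q e1) + (arc (q e2) + g)"
    using assms(1-4) p(3) by simp
  moreover have "arc (q e1) + (arc (q e2) + g) = g + dipole y z"
    using assms(4) by (simp add: q_def arc_def fun_eq_iff)
  ultimately show ?thesis unfolding strongly_realizable_def by metis
qed

lemma strongly_realizable_triangle:
  assumes "distinct [x1, x2, x3]" "distinct [e1, e2, e3]"
    "en e1 = {x1, x2}" "en e2 = {x2, x3}" "en e3 = {x1, x3}"
  shows "strongly_realizable en {x1, x2, x3} {e1, e2, e3} 0"
proof -
  define p where "p = (\<lambda>e. if e = e1 then (x1, x2) else if e = e2 then (x2, x3) else (x3, x1))"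
  have p: "p e1 = (x1, x2)" "p e2 = (x2, x3)" "p e3 = (x3, x1)"
    using assms(2) by (auto simp: p_def)
  have "orients en {e1, e2, e3} p" using assms(3-5) p by (auto simp: orients_def)
  moreover have "strong {x1, x2, x3} {e1, e2, e3} p"
    unfolding strong_def using p by auto
  moreover have "(\<Sum>e\<in>{e1, e2, e3}. arc (p e)) = arc (p e1) + (arc (p e2) + arc (p e3))"
    using assms(2) by simp
  moreover have "\<dots> = 0" unfolding p by (simp add: arc_def fun_eq_iff)
  ultimately show ?thesis unfolding strongly_realizable_def by metis
qed

section \<open>Strong orientations with independent binary choices\<close>

text \<open>\<open>b\<close> is the boundary when all \<open>m\<close> choices are at their default,
  and \<open>d i\<close> is the effect of switching choice \<open>i\<close>. The choices must be
  independent, since the counting argument switches arbitrary subsets.\<close>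

definition flexible :: "('e \<Rightarrow> 'v set) \<Rightarrow> 'v set \<Rightarrow> 'e set \<Rightarrow> nat \<Rightarrow> bool" where
  "flexible en V E m \<longleftrightarrow> (\<exists>b d.
    (\<forall>i<m. \<exists>y\<in>V. \<exists>z\<in>V. y \<noteq> z \<and> d i = dipole y z) \<and>
    (\<forall>J\<subseteq>{..<m}. strongly_realizable en V E (b + (\<Sum>i\<in>J. d i))))"

lemma flexible_0: "strongly_realizable en V E b \<Longrightarrow> flexible en V E 0"
  unfolding flexible_def by (intro exI[of _ b]) simp

text \<open>The two options contribute opposite dipoles. With \<open>dipole y z\<close> as the
  default, switching subtracts it twice, that is, adds it once modulo 3; so the new shift is itself
  a dipole.\<close>

lemma flexible_Suc:
  assumes "flexible en V E m" "V \<subseteq> V'" "y \<in> V'" "z \<in> V'" "y \<noteq> z"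
    and step: "\<And>g. strongly_realizable en V E g \<Longrightarrow> strongly_realizable en V' E' (g + dipole y z)"
      "\<And>g. strongly_realizable en V E g \<Longrightarrow> strongly_realizable en V' E' (g + dipole z y)"
  shows "flexible en V' E' (Suc m)"
proof -
  obtain b d where d: "\<forall>i<m. \<exists>y\<in>V. \<exists>z\<in>V. y \<noteq> z \<and> d i = dipole y z"
    and b: "\<forall>J\<subseteq>{..<m}. strongly_realizable en V E (b + (\<Sum>i\<in>J. d i))"
    using assms(1) unfolding flexible_def by blast
  define d' where "d' = d(m := dipole y z)"
  have "strongly_realizable en V' E' (b + dipole y z + (\<Sum>i\<in>J. d' i))" if J: "J \<subseteq> {..<Suc m}" for J
  proof -
    have fin: "finite J" using J finite_subset by blast
    have sub: "J - {m} \<subseteq> {..<m}" using J by auto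
    have sr: "strongly_realizable en V E (b + (\<Sum>i\<in>J - {m}. d i))" using b sub by blast
    have eq: "(\<Sum>i\<in>J - {m}. d' i) = (\<Sum>i\<in>J - {m}. d i)" by (rule sum.cong) (auto simp: d'_def)
    show ?thesis
    proof (cases "m \<in> J")
      case True
      have "(\<Sum>i\<in>J. d' i) = dipole y z + (\<Sum>i\<in>J - {m}. d i)"
        using sum.remove[OF fin True, of d'] eq by (simp add: d'_def)
      moreover have "b + dipole y z + (dipole y z + s) = b + s + dipole z y" for s
      proof
        fix v show "(b + dipole y z + (dipole y z + s)) v = (b + s + dipole z y) v"
          using add_self_three[of "dipole y z v"]
          by (simp add: dipole_swap[of z y] algebra_simps)
      qed
      ultimately show ?thesis using step(2)[OF sr] by metis
    next
      case False
      then have "(\<Sum>i\<in>J. d' i) = (\<Sum>i\<in>J - {m}. d i)" using eq by simp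
      moreover have "b + dipole y z + s = b + s + dipole y z" for s by (simp add: fun_eq_iff)
      ultimately show ?thesis using step(1)[OF sr] by metis
    qed
  qed
  moreover have "\<forall>i<Suc m. \<exists>y\<in>V'. \<exists>z\<in>V'. y \<noteq> z \<and> d' i = dipole y z"
  proof (intro allI impI)
    fix i assume "i < Suc m"
    then consider "i = m" | "i < m" by linarith
    then show "\<exists>y\<in>V'. \<exists>z\<in>V'. y \<noteq> z \<and> d' i = dipole y z"
    proof cases
      case 1
      then show ?thesis using assms(3-5) by (auto simp: d'_def)
    next
      case 2
      then have "\<exists>y\<in>V. \<exists>z\<in>V. y \<noteq> z \<and> d i = dipole y z" using d by blast
      then show ?thesis using assms(2) 2 by (auto simp: d'_def)
    qed
  qed
  ultimately show ?thesis unfolding flexible_def by blast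
qed

text \<open>Every ear can be traversed in either direction. The starting triangle offers no choice,
  as both of its cyclic orientations have boundary 0; this is why the count is
  \<open>card V - 3\<close>.\<close>

lemma ttree_flexible: "ttree en V E \<Longrightarrow> flexible en V E (card V - 3)"
proof (induction rule: ttree.induct)
  case (base x1 x2 x3 e1 e2 e3)
  then have "card {x1, x2, x3} - 3 = 0" by simp
  then show ?case using flexible_0[OF strongly_realizable_triangle[OF base]] by metis
next
  case (ear V E x e y z e1 e2)
  have fin: "finite V" "finite E" and yz: "y \<in> V" "z \<in> V" and "3 \<le> card V"
    using ttree_finite[OF ear(1)] ear(3,4) by auto
  have "flexible en (insert x V) (insert e1 (insert e2 E)) (Suc (card V - 3))"
  proof (rule flexible_Suc[OF ear.IH, of _ y z])
    fix g assume g: "strongly_realizable en V E g"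
    show "strongly_realizable en (insert x V) (insert e1 (insert e2 E)) (g + dipole y z)"
      by (rule strongly_realizable_ear) (use ear fin yz g in auto)
    \<comment> \<open>Exchanging the two ear edges exchanges \<open>y\<close> and \<open>z\<close>,
      which is the path in the other direction.\<close>
    have "strongly_realizable en (insert x V) (insert e2 (insert e1 E)) (g + dipole z y)"
      by (rule strongly_realizable_ear) (use ear fin yz g in auto)
    then show "strongly_realizable en (insert x V) (insert e1 (insert e2 E)) (g + dipole z y)"
      by (simp only: insert_commute)
  qed (use yz ear(5) in auto)
  moreover have "card (insert x V) - 3 = Suc (card V - 3)"
    using fin(1) ear(2) \<open>3 \<le> card V\<close> by simp
  ultimately show ?case by simp
qed

lemma flexible_union:
  assumes "finite E" "finite F" "E \<inter> F = {}" "\<forall>e\<in>F. en e \<subseteq> V \<and> card (en e) = 2" "flexible en V E m"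
  shows "flexible en V (E \<union> F) (m + card F)"
  using assms(2-4)
proof (induction F rule: finite_induct)
  case empty
  then show ?case using assms(5) by simp
next
  case (insert e F)
  obtain y z where e: "en e = {y, z}" "y \<noteq> z"
    using insert.prems(2) by (auto simp: card_2_iff)
  have "e \<notin> E \<union> F" "finite (E \<union> F)" using insert assms(1) by auto
  have "flexible en V (insert e (E \<union> F)) (Suc (m + card F))"
  proof (rule flexible_Suc[of _ _ "E \<union> F" _ _ y z])
    show "flexible en V (E \<union> F) (m + card F)" using insert by auto
    show "y \<in> V" "z \<in> V" using insert.prems(2) e by auto
  next
    fix g assume g: "strongly_realizable en V (E \<union> F) g"
    show "strongly_realizable en V (insert e (E \<union> F)) (g + dipole y z)"
      by (rule strongly_realizable_insert) (use \<open>e \<notin> E \<union> F\<close> \<open>finite (E \<union> F)\<close> e g in auto)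
    show "strongly_realizable en V (insert e (E \<union> F)) (g + dipole z y)"
      by (rule strongly_realizable_insert) (use \<open>e \<notin> E \<union> F\<close> \<open>finite (E \<union> F)\<close> e g in auto)
  qed (use e in auto)
  then show ?case using insert.hyps by simp
qed

section \<open>Triangle-trees on three and four vertices\<close>

text \<open>The complete graph on four vertices without one edge: two triangles glued along
  \<open>y\<close>, \<open>z\<close>, with the nonadjacent tips \<open>a\<close> and
  \<open>b\<close>.\<close>

definition diamond :: "('e \<Rightarrow> 'v set) \<Rightarrow> 'v \<Rightarrow> 'v \<Rightarrow> 'v \<Rightarrow> 'v \<Rightarrow> 'e set \<Rightarrow> bool" where
  "diamond en a b y z E \<longleftrightarrow> distinct [a, b, y, z] \<and>
    (\<exists>e0 e1 e2 e3 e4. distinct [e0, e1, e2, e3, e4] \<and> E = {e0, e1, e2, e3, e4} \<and>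
      en e0 = {y, z} \<and> en e1 = {a, y} \<and> en e2 = {a, z} \<and> en e3 = {b, y} \<and> en e4 = {b, z})"

lemma diamondI:
  assumes "distinct [a, b, y, z]" "distinct [e0, e1, e2, e3, e4]" "E = {e0, e1, e2, e3, e4}"
    "en e0 = {y, z}" "en e1 = {a, y}" "en e2 = {a, z}" "en e3 = {b, y}" "en e4 = {b, z}"
  shows "diamond en a b y z E"
  unfolding diamond_def using assms by blast

lemma diamondE:
  assumes "diamond en a b y z E"
  obtains e0 e1 e2 e3 e4 where "distinct [a, b, y, z]" "distinct [e0, e1, e2, e3, e4]"
    "E = {e0, e1, e2, e3, e4}"
    "en e0 = {y, z}" "en e1 = {a, y}" "en e2 = {a, z}" "en e3 = {b, y}" "en e4 = {b, z}"
  using assms unfolding diamond_def by blast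

lemma diamond_swap_tips: "diamond en a b y z E \<Longrightarrow> diamond en b a y z E"
  by (elim diamondE, rule_tac ?e0.0 = e0 and ?e1.0 = e3 and ?e2.0 = e4 and ?e3.0 = e1 and ?e4.0 = e2
      in diamondI) auto

lemma diamond_swap_middle: "diamond en a b y z E \<Longrightarrow> diamond en a b z y E"
  by (elim diamondE, rule_tac ?e0.0 = e0 and ?e1.0 = e2 and ?e2.0 = e1 and ?e3.0 = e4 and ?e4.0 = e3
      in diamondI) auto

lemma ttree_card_3:
  assumes "ttree en V E" "card V = 3"
  shows "strongly_realizable en V E 0"
  using assms(1)
proof cases
  case (base x1 x2 x3 e1 e2 e3)
  then show ?thesis using strongly_realizable_triangle by metis
next
  case (ear V' E' x e y z e1 e2)
  then show ?thesis using assms(2) ttree_finite[OF ear(3)] by simp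
qed

lemma ttree_card_3_edge:
  assumes "ttree en V E" "card V = 3" "e \<in> E" "en e = {y, z}"
  shows "\<exists>b f g. V = {b, y, z} \<and> E = {e, f, g} \<and> distinct [b, y, z] \<and> distinct [e, f, g] \<and>
    en f = {b, y} \<and> en g = {b, z}"
  using assms(1)
proof cases
  case (ear V' E' x e y z e1 e2)
  then show ?thesis using assms(2) ttree_finite[OF ear(3)] by simp
next
  case (base x1 x2 x3 e1 e2 e3)
  have ne: "x1 \<noteq> x2" "x2 \<noteq> x1" "x1 \<noteq> x3" "x3 \<noteq> x1" "x2 \<noteq> x3" "x3 \<noteq> x2"
    "e1 \<noteq> e2" "e2 \<noteq> e1" "e1 \<noteq> e3" "e3 \<noteq> e1" "e2 \<noteq> e3" "e3 \<noteq> e2"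
    using base(3,4) by auto
  have swap: ?thesis
    if "V = {w, u, v}" "E = {e, f, g}" "distinct [w, u, v]" "distinct [e, f, g]"
      "en e = {u, v}" "en f = {w, u}" "en g = {w, v}" for u v w f g
  proof -
    have "(y = u \<and> z = v) \<or> (y = v \<and> z = u)"
      using assms(4) that(5) by (auto simp: doubleton_eq_iff)
    then show ?thesis
    proof
      assume "y = u \<and> z = v"
      then show ?thesis using that by blast
    next
      assume yz: "y = v \<and> z = u"
      have "V = {w, y, z}" "E = {e, g, f}" "distinct [w, y, z]" "distinct [e, g, f]"
        "en g = {w, y}" "en f = {w, z}"
        using that yz by (simp_all add: insert_commute eq_commute)
      then show ?thesis by blast
    qed
  qed
  consider "e = e1" | "e = e2" | "e = e3" using assms(3) base(2) by blast
  then show ?thesis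
  proof cases
    case 1
    show ?thesis by (rule swap[of x3 x1 x2 e3 e2]) (use 1 base ne in \<open>simp_all add: insert_commute\<close>)
  next
    case 2
    show ?thesis by (rule swap[of x1 x2 x3 e1 e3]) (use 2 base ne in \<open>simp_all add: insert_commute\<close>)
  next
    case 3
    show ?thesis by (rule swap[of x2 x1 x3 e1 e2]) (use 3 base ne in \<open>simp_all add: insert_commute\<close>)
  qed
qed

lemma ttree_card_4:
  assumes "ttree en V E" "card V = 4"
  shows "\<exists>a b y z. V = {a, b, y, z} \<and> diamond en a b y z E"
  using assms(1)
proof cases
  case (base x1 x2 x3 e1 e2 e3)
  then show ?thesis using assms(2) by simp
next
  case (ear V' E' x e y z e1 e2)
  then have "card V' = 3" using assms(2) ttree_finite[OF ear(3)] by simp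
  then obtain b f g where bfg: "V' = {b, y, z}" "E' = {e, f, g}" "distinct [b, y, z]" "distinct [e, f, g]"
    "en f = {b, y}" "en g = {b, z}"
    using ttree_card_3_edge[OF ear(3) _ ear(5,6)] by blast
  have "x \<noteq> b" "x \<noteq> y" "x \<noteq> z" "e1 \<noteq> e" "e1 \<noteq> f" "e1 \<noteq> g" "e2 \<noteq> e" "e2 \<noteq> f" "e2 \<noteq> g"
    using ear(4,9,10) bfg(1,2) by auto
  then have "diamond en x b y z E"
    using bfg ear by (intro diamondI[of _ _ _ _ e e1 e2 f g]) auto
  moreover have "V = {x, b, y, z}" using ear(1) bfg(1) by simp
  ultimately show ?thesis by blast
qed

text \<open>The tip \<open>a\<close> can be taken as the vertex added last, so
  \<open>ttree_ear_realizable\<close> applies; by symmetry the same holds for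
  \<open>b\<close>.\<close>

lemma diamond_realizable:
  assumes "diamond en a b y z E" "zero_sum {a, b, y, z} g" "g a = 0"
  shows "realizable en E g"
proof -
  obtain e0 e1 e2 e3 e4 where D: "distinct [a, b, y, z]" "distinct [e0, e1, e2, e3, e4]"
    "E = {e0, e1, e2, e3, e4}"
    "en e0 = {y, z}" "en e1 = {a, y}" "en e2 = {a, z}" "en e3 = {b, y}" "en e4 = {b, z}"
    using assms(1) by (rule diamondE)
  have "ttree en {b, y, z} {e3, e0, e4}"
    by (rule ttree.base) (use D in auto)
  then have "realizable en (insert e1 (insert e2 {e3, e0, e4})) g"
    by (rule ttree_ear_realizable[where x = a and e = e0 and y = y and z = z]) (use D assms in auto)
  moreover have "insert e1 (insert e2 {e3, e0, e4}) = E" using D(3) by auto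
  ultimately show ?thesis by simp
qed

lemma diamond_strongly_realizable:
  assumes "diamond en a b y z E"
  shows "strongly_realizable en {a, b, y, z} E (dipole y z)"
proof -
  obtain e0 e1 e2 e3 e4 where D: "distinct [a, b, y, z]" "distinct [e0, e1, e2, e3, e4]"
    "E = {e0, e1, e2, e3, e4}"
    "en e0 = {y, z}" "en e1 = {a, y}" "en e2 = {a, z}" "en e3 = {b, y}" "en e4 = {b, z}"
    using assms by (rule diamondE)
  have "strongly_realizable en {b, y, z} {e3, e0, e4} 0"
    by (rule strongly_realizable_triangle) (use D in auto)
  then have "strongly_realizable en (insert a {b, y, z}) (insert e1 (insert e2 {e3, e0, e4})) (0 + dipole y z)"
    by (rule strongly_realizable_ear[rotated -1]) (use D in auto)
  moreover have "insert e1 (insert e2 {e3, e0, e4}) = E" using D(3) by auto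
  ultimately show ?thesis by simp
qed

text \<open>Here correcting \<open>E\<close> by \<open>F\<close> fails: \<open>dipole z y\<close> is
  the difference of the two triangle indicators of \<open>F\<close>, and \<open>F\<close> does not
  realize it. So the strong part mixes both diamonds: a cyclic triangle on \<open>a\<close>,
  \<open>y\<close>, \<open>z\<close> from \<open>E\<close> and an ear from \<open>y\<close> through
  \<open>b\<close> to \<open>a\<close> with one edge of each. The remaining five edges all run from
  \<open>y\<close> or \<open>z\<close> to \<open>a\<close> or \<open>b\<close>, which makes the
  total 3 at \<open>y\<close> and \<open>z\<close> and -3 at \<open>a\<close> and
  \<open>b\<close>.\<close>

lemma crossed_diamonds_strongly_realizable:
  assumes "diamond en a b y z E" "diamond en y z a b F" "E \<inter> F = {}"
  shows "strongly_realizable en {a, b, y, z} (E \<union> F) 0"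
proof -
  obtain e0 e1 e2 e3 e4 where E: "distinct [a, b, y, z]" "distinct [e0, e1, e2, e3, e4]"
    "E = {e0, e1, e2, e3, e4}"
    "en e0 = {y, z}" "en e1 = {a, y}" "en e2 = {a, z}" "en e3 = {b, y}" "en e4 = {b, z}"
    using assms(1) by (rule diamondE)
  obtain f0 f1 f2 f3 f4 where F: "distinct [f0, f1, f2, f3, f4]" "F = {f0, f1, f2, f3, f4}"
    "en f0 = {a, b}" "en f1 = {y, a}" "en f2 = {y, b}" "en f3 = {z, a}" "en f4 = {z, b}"
    using assms(2) by (rule diamondE)
  have "strongly_realizable en {a, y, z} {e1, e0, e2} 0"
    by (rule strongly_realizable_triangle) (use E in auto)
  then have "strongly_realizable en (insert b {a, y, z}) (insert e3 (insert f0 {e1, e0, e2})) (0 + dipole y a)"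
    by (rule strongly_realizable_ear[rotated -1]) (use E F assms(3) in auto)
  then have "strongly_realizable en {a, b, y, z} {e3, f0, e1, e0, e2} (0 + dipole y a)"
    by (simp only: insert_commute)
  then have "strongly_realizable en {a, b, y, z} {e4, e3, f0, e1, e0, e2} (0 + dipole y a + dipole z b)"
    by (rule strongly_realizable_insert[rotated -1]) (use E F assms(3) in auto)
  then have "strongly_realizable en {a, b, y, z} {f1, e4, e3, f0, e1, e0, e2}
      (0 + dipole y a + dipole z b + dipole y a)"
    by (rule strongly_realizable_insert[rotated -1]) (use E F assms(3) in auto)
  then have "strongly_realizable en {a, b, y, z} {f2, f1, e4, e3, f0, e1, e0, e2}
      (0 + dipole y a + dipole z b + dipole y a + dipole y b)"
    by (rule strongly_realizable_insert[rotated -1]) (use E F assms(3) in auto)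
  then have "strongly_realizable en {a, b, y, z} {f3, f2, f1, e4, e3, f0, e1, e0, e2}
      (0 + dipole y a + dipole z b + dipole y a + dipole y b + dipole z a)"
    by (rule strongly_realizable_insert[rotated -1]) (use E F assms(3) in auto)
  then have "strongly_realizable en {a, b, y, z} {f4, f3, f2, f1, e4, e3, f0, e1, e0, e2}
      (0 + dipole y a + dipole z b + dipole y a + dipole y b + dipole z a + dipole z b)"
    by (rule strongly_realizable_insert[rotated -1]) (use E F assms(3) in auto)
  moreover have "0 + dipole y a + dipole z b + dipole y a + dipole y b + dipole z a + dipole z b = 0"
    using E(1) by (auto simp: fun_eq_iff arc_def)
  moreover have "{f4, f3, f2, f1, e4, e3, f0, e1, e0, e2} = E \<union> F" using E(3) F(2) by auto
  ultimately show ?thesis by simp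
qed

text \<open>\<open>E\<close> leaves \<open>dipole y z\<close>, so \<open>F\<close> should realize
  \<open>dipole z y\<close>. It does if one of its tips lies outside \<open>y\<close>,
  \<open>z\<close>, because the dipole vanishes there; otherwise its tips are exactly
  \<open>y\<close> and \<open>z\<close>, which is the crossed position.\<close>

lemma two_diamonds_strongly_realizable:
  assumes "diamond en a b y z E" "diamond en a' b' y' z' F" "{a, b, y, z} = {a', b', y', z'}" "E \<inter> F = {}"
  shows "strongly_realizable en {a, b, y, z} (E \<union> F) 0"
proof -
  have fin: "finite E" "finite F" using assms(1,2) by (auto elim!: diamondE)
  have d: "distinct [a, b, y, z]" "distinct [a', b', y', z']" using assms(1,2) by (auto elim!: diamondE)
  have glue: "strongly_realizable en {a, b, y, z} (E \<union> F) 0" if "realizable en F (dipole z y)"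
  proof -
    have "dipole y z + dipole z y = 0" by (simp add: fun_eq_iff arc_def)
    then show ?thesis
      using strongly_realizable_union[OF fin assms(4) diamond_strongly_realizable[OF assms(1)] that] by metis
  qed
  have zs: "zero_sum {a, b, y, z} (dipole z y)" by (rule zero_sum_arc) auto
  consider "a' \<in> {a, b}" | "b' \<in> {a, b}" | "a' \<in> {y, z}" "b' \<in> {y, z}" using assms(3) by blast
  then show ?thesis
  proof cases
    case 1
    then have "dipole z y a' = 0" using d(1) by (auto simp: arc_def)
    then show ?thesis
      using glue diamond_realizable[OF assms(2), of "dipole z y"] zs unfolding assms(3) by blast
  next
    case 2
    then have "dipole z y b' = 0" using d(1) by (auto simp: arc_def)
    then show ?thesis
      using glue diamond_realizable[OF diamond_swap_tips[OF assms(2)], of "dipole z y"] zs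
      unfolding assms(3) by (simp add: insert_commute)
  next
    case 3
    then have ab: "(a' = y \<and> b' = z) \<or> (a' = z \<and> b' = y)" using d(2) by auto
    have "y' \<in> {a, b, y, z}" "z' \<in> {a, b, y, z}" unfolding assms(3) by auto
    then have "(y' = a \<and> z' = b) \<or> (y' = b \<and> z' = a)" using ab d(2) by auto
    then have "diamond en y z a b F"
      using ab assms(2) diamond_swap_tips diamond_swap_middle by metis
    then show ?thesis by (rule crossed_diamonds_strongly_realizable[OF assms(1) _ assms(4)])
  qed
qed

section \<open>Combining the two trees\<close>

lemma two_ttrees_strongly_realizable:
  assumes T1: "ttree en V E1" and T2: "ttree en V E2" and "E1 \<inter> E2 = {}" "E1 \<subseteq> E" "E2 \<subseteq> E"
    and "finite E" and ends: "\<forall>e\<in>E. en e \<subseteq> V \<and> card (en e) = 2"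
  shows "strongly_realizable en V E 0"
proof (rule ccontr)
  assume neg: "\<not> strongly_realizable en V E 0"
  have fin: "finite V" "finite E1" "finite E2" "3 \<le> card V"
    using ttree_finite[OF T1] ttree_finite[OF T2] by auto
  let ?F = "E - E2 - E1"
  have "flexible en V (E1 \<union> ?F) (card V - 3 + card ?F)"
    by (rule flexible_union[OF _ _ _ _ ttree_flexible[OF T1]]) (use assms fin in auto)
  moreover have F: "E1 \<union> ?F = E - E2" using assms(3,4) by auto
  ultimately obtain b d where
    d: "\<forall>i<card V - 3 + card ?F. \<exists>y\<in>V. \<exists>z\<in>V. y \<noteq> z \<and> d i = dipole y z" and
    b: "\<forall>J\<subseteq>{..<card V - 3 + card ?F}. strongly_realizable en V (E - E2) (b + (\<Sum>i\<in>J. d i))"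
    unfolding flexible_def by metis
  have "strongly_realizable en V (E - E2) (b + (\<Sum>i\<in>{}. d i))" using b by blast
  then have "zero_sum V b"
    using strongly_realizable_zero_sum[of en V "E - E2" b] fin(1) ends by simp
  have "2 * card {..<card V - 3 + card ?F} \<le> card V - 2"
  \<comment> \<open>The second tree has to supply the negative of what the other edges leave, so the
    shifts are negated; each remains a dipole with its ends exchanged.\<close>
  proof (rule unrealizable_dipoles_bound[OF T2, where g = "- b" and d = "\<lambda>i. - d i"])
    show "zero_sum V (- b)" by (rule zero_sum_uminus) fact
  next
    fix i assume "i \<in> {..<card V - 3 + card ?F}"
    then obtain y z where "y \<in> V" "z \<in> V" "y \<noteq> z" "d i = dipole y z" using d by blast
    then show "\<exists>y\<in>V. \<exists>z\<in>V. y \<noteq> z \<and> - d i = dipole y z"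
      by (intro bexI[of _ z] bexI[of _ y]) (auto simp: dipole_swap[of z y])
  next
    fix J assume J: "J \<subseteq> {..<card V - 3 + card ?F}"
    show "\<not> realizable en E2 (- b + (\<Sum>i\<in>J. - d i))"
    proof
      assume "realizable en E2 (- b + (\<Sum>i\<in>J. - d i))"
      then have "strongly_realizable en V ((E - E2) \<union> E2) (b + (\<Sum>i\<in>J. d i) + (- b + (\<Sum>i\<in>J. - d i)))"
        using b J fin(3) assms(6) by (intro strongly_realizable_union) auto
      moreover have "b + (\<Sum>i\<in>J. d i) + (- b + (\<Sum>i\<in>J. - d i)) = 0"
        by (simp only: sum_negf) (simp add: fun_eq_iff)
      moreover have "(E - E2) \<union> E2 = E" using assms(5) by auto
      ultimately show False using neg by simp
    qed
  qed simp
  \<comment> \<open>With n vertices and k edges outside both trees this says n + 2k <= 4; as n >= 3,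
    it forces k = 0.\<close>
  then have small: "2 * (card V - 3 + card ?F) \<le> card V - 2" by simp
  then have "card ?F = 0" "card V = 3 \<or> card V = 4" using fin(4) by arith+
  then have "?F = {}" using assms(6) by simp
  then have E: "E = E1 \<union> E2" using assms(4,5) by blast
  from \<open>card V = 3 \<or> card V = 4\<close> show False
  proof
    assume "card V = 3"
    then have "strongly_realizable en V (E1 \<union> E2) (0 + 0)"
      using ttree_card_3[OF T1] strongly_realizable_imp[OF ttree_card_3[OF T2]] fin assms(3)
      by (intro strongly_realizable_union) auto
    then show False using neg E by simp
  next
    assume "card V = 4"
    then obtain a b y z a' b' y' z' where "V = {a, b, y, z}" "diamond en a b y z E1"
      "V = {a', b', y', z'}" "diamond en a' b' y' z' E2"
      using ttree_card_4[OF T1] ttree_card_4[OF T2] by metis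
    then show False using two_diamonds_strongly_realizable[of en a b y z E1 a' b' y' z' E2] assms(3) neg E
      by simp
  qed
qed

section \<open>Circulations and the flow index\<close>

definition net :: "'e set \<Rightarrow> ('e \<Rightarrow> 'v \<times> 'v) \<Rightarrow> ('e \<Rightarrow> int) \<Rightarrow> 'v \<Rightarrow> int" where
  "net E p f v = (\<Sum>e\<in>E. (of_bool (fst (p e) = v) - of_bool (snd (p e) = v)) * f e)"

definition leaving :: "'e set \<Rightarrow> ('e \<Rightarrow> 'v \<times> 'v) \<Rightarrow> 'v set \<Rightarrow> 'e set" where
  "leaving E p X = {e \<in> E. fst (p e) \<in> X \<and> snd (p e) \<notin> X}"

definition entering :: "'e set \<Rightarrow> ('e \<Rightarrow> 'v \<times> 'v) \<Rightarrow> 'v set \<Rightarrow> 'e set" where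
  "entering E p X = {e \<in> E. snd (p e) \<in> X \<and> fst (p e) \<notin> X}"

lemma sum_net:
  assumes "finite X"
  shows "(\<Sum>v\<in>X. net E p f v) =
    (\<Sum>e\<in>E. (of_bool (fst (p e) \<in> X) - of_bool (snd (p e) \<in> X)) * f e)"
proof -
  have b: "(\<Sum>v\<in>X. of_bool (w = v)) = (of_bool (w \<in> X) :: int)" for w
    using assms by (auto simp: of_bool_def)
  have "(\<Sum>v\<in>X. net E p f v) =
    (\<Sum>e\<in>E. \<Sum>v\<in>X. (of_bool (fst (p e) = v) - of_bool (snd (p e) = v)) * f e)"
    unfolding net_def by (rule sum.swap)
  also have "\<dots> = (\<Sum>e\<in>E. ((\<Sum>v\<in>X. of_bool (fst (p e) = v)) - (\<Sum>v\<in>X. of_bool (snd (p e) = v))) * f e)"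
    by (simp only: sum_distrib_right[symmetric] sum_subtractf)
  finally show ?thesis unfolding b .
qed

lemma sum_net_cut:
  assumes "finite E" "finite X"
  shows "(\<Sum>v\<in>X. net E p f v) = (\<Sum>e\<in>leaving E p X. f e) - (\<Sum>e\<in>entering E p X. f e)"
proof -
  have "(\<Sum>v\<in>X. net E p f v) =
      (\<Sum>e\<in>E. (if fst (p e) \<in> X \<and> snd (p e) \<notin> X then f e else 0) -
        (if snd (p e) \<in> X \<and> fst (p e) \<notin> X then f e else 0))"
    unfolding sum_net[OF assms(2)] by (rule sum.cong) auto
  then show ?thesis
    using assms(1) by (simp add: sum_subtractf sum.inter_filter leaving_def entering_def)
qed

text \<open>Room left by the bounds across the cut of \<open>X\<close>: a flow between
  \<open>l\<close> and \<open>u\<close> with net outflow \<open>b\<close> sends the sum of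
  \<open>b\<close> over \<open>X\<close> out of \<open>X\<close>, so a nonnegative slack is
  necessary. Hoffman's theorem is the converse.\<close>

definition slack ::
  "'e set \<Rightarrow> ('e \<Rightarrow> 'v \<times> 'v) \<Rightarrow> ('e \<Rightarrow> int) \<Rightarrow> ('e \<Rightarrow> int) \<Rightarrow> ('v \<Rightarrow> int) \<Rightarrow> 'v set \<Rightarrow> int" where
  "slack E p l u b X = (\<Sum>e\<in>leaving E p X. u e) - (\<Sum>e\<in>entering E p X. l e) - (\<Sum>v\<in>X. b v)"

text \<open>Submodularity with a quantified gain: \<open>e0\<close> runs from \<open>X - Y\<close>
  to \<open>Y - X\<close>, so it counts \<open>u e0\<close> for \<open>X\<close> and
  \<open>- l e0\<close> for \<open>Y\<close>, but crosses neither the intersection nor the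
  union.\<close>

lemma slack_uncross:
  assumes "finite E" "finite X" "finite Y" "\<forall>e\<in>E. l e \<le> u e" "e0 \<in> leaving E p X" "e0 \<in> entering E p Y"
  shows "slack E p l u b (X \<inter> Y) + slack E p l u b (X \<union> Y) + (u e0 - l e0) \<le>
    slack E p l u b X + slack E p l u b Y"
proof -
  define c where "c Z e = (if fst (p e) \<in> Z \<and> snd (p e) \<notin> Z then u e else 0) -
        (if snd (p e) \<in> Z \<and> fst (p e) \<notin> Z then l e else 0)" for Z e
  have s: "slack E p l u b Z = (\<Sum>e\<in>E. c Z e) - (\<Sum>v\<in>Z. b v)" for Z
    using assms(1) by (simp add: slack_def c_def sum_subtractf sum.inter_filter leaving_def entering_def)
  have e0: "e0 \<in> E" "fst (p e0) \<in> X - Y" "snd (p e0) \<in> Y - X"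
    using assms(5,6) by (auto simp: leaving_def entering_def)
  have le: "c (X \<inter> Y) e + c (X \<union> Y) e + (if e = e0 then u e0 - l e0 else 0) \<le> c X e + c Y e"
    if "e \<in> E" for e
  proof -
    have "l e \<le> u e" using assms(4) that by blast
    then show ?thesis
      using e0(2,3)
      by (cases "fst (p e) \<in> X"; cases "fst (p e) \<in> Y"; cases "snd (p e) \<in> X"; cases "snd (p e) \<in> Y")
        (auto simp: c_def)
  qed
  have "(\<Sum>e\<in>E. c (X \<inter> Y) e + c (X \<union> Y) e + (if e = e0 then u e0 - l e0 else 0)) \<le> (\<Sum>e\<in>E. c X e + c Y e)"
    by (rule sum_mono) (rule le)
  moreover have "(\<Sum>e\<in>E. c (X \<inter> Y) e + c (X \<union> Y) e + (if e = e0 then u e0 - l e0 else 0)) =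
      (\<Sum>e\<in>E. c (X \<inter> Y) e) + (\<Sum>e\<in>E. c (X \<union> Y) e) + (u e0 - l e0)"
    using assms(1) e0(1) by (simp add: sum.distrib)
  moreover have "(\<Sum>v\<in>X \<union> Y. b v) + (\<Sum>v\<in>X \<inter> Y. b v) = (\<Sum>v\<in>X. b v) + (\<Sum>v\<in>Y. b v)"
    using assms(2,3) by (rule sum.union_inter)
  ultimately show ?thesis by (simp add: s sum.distrib)
qed

lemma slack_decr_upper:
  assumes "finite E"
  shows "slack E p l (u(e0 := u e0 - 1)) b X = slack E p l u b X - of_bool (e0 \<in> leaving E p X)"
proof -
  have fin: "finite (leaving E p X)" using assms by (simp add: leaving_def)
  have "(\<Sum>e\<in>leaving E p X. (u(e0 := u e0 - 1)) e) =
      (\<Sum>e\<in>leaving E p X. u e - (if e = e0 then 1 else 0))"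
    by (rule sum.cong) auto
  also have "\<dots> = (\<Sum>e\<in>leaving E p X. u e) - of_bool (e0 \<in> leaving E p X)"
    using fin by (simp add: sum_subtractf)
  finally show ?thesis by (simp add: slack_def)
qed

lemma slack_incr_lower:
  assumes "finite E"
  shows "slack E p (l(e0 := l e0 + 1)) u b X = slack E p l u b X - of_bool (e0 \<in> entering E p X)"
proof -
  have fin: "finite (entering E p X)" using assms by (simp add: entering_def)
  have "(\<Sum>e\<in>entering E p X. (l(e0 := l e0 + 1)) e) =
      (\<Sum>e\<in>entering E p X. l e + (if e = e0 then 1 else 0))"
    by (rule sum.cong) auto
  also have "\<dots> = (\<Sum>e\<in>entering E p X. l e) + of_bool (e0 \<in> entering E p X)"
    using fin by (simp add: sum.distrib)
  finally show ?thesis by (simp add: slack_def)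
qed

text \<open>Hoffman's circulation theorem. Some bound of an edge with \<open>l < u\<close> can be tightened: otherwise
  two tight sets are separated by that edge in opposite directions, and uncrossing them gives a
  negative slack.\<close>

lemma hoffman_circulation:
  assumes "finite V" "finite E" "\<forall>e\<in>E. fst (p e) \<in> V \<and> snd (p e) \<in> V"
    and "(\<Sum>v\<in>V. b v) = 0" "\<forall>e\<in>E. l e \<le> u e" "\<forall>X\<subseteq>V. 0 \<le> slack E p l u b X"
  shows "\<exists>f. (\<forall>e\<in>E. l e \<le> f e \<and> f e \<le> u e) \<and> (\<forall>v\<in>V. net E p f v = b v)"
  using assms(5,6)
proof (induction "nat (\<Sum>e\<in>E. u e - l e)" arbitrary: l u rule: less_induct)
  case less
  show ?case
  proof (cases "\<exists>e0\<in>E. l e0 < u e0")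
    case False
    then have lu: "l e = u e" if "e \<in> E" for e using less.prems(1) that by force
    \<comment> \<open>The bounds now determine the flow. Singleton cuts give one inequality at every
      vertex, and since both sides have total 0 over \<open>V\<close>, all of them are
      equalities.\<close>
    have "0 \<le> net E p u v - b v" if "v \<in> V" for v
    proof -
      have "(\<Sum>e\<in>entering E p {v}. l e) = (\<Sum>e\<in>entering E p {v}. u e)"
        by (rule sum.cong) (auto simp: entering_def lu)
      then have "slack E p l u b {v} = (\<Sum>w\<in>{v}. net E p u w) - b v"
        using sum_net_cut[OF assms(2), of "{v}" p u] by (simp add: slack_def)
      then show ?thesis using less.prems(2)[rule_format, of "{v}"] that by simp
    qed
    moreover have "(\<Sum>v\<in>V. net E p u v - b v) = 0"
    proof -
      have "(\<Sum>v\<in>V. net E p u v) = 0"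
        unfolding sum_net[OF assms(1)] using assms(3) by (intro sum.neutral) auto
      then show ?thesis using assms(4) by (simp add: sum_subtractf)
    qed
    ultimately have "\<forall>v\<in>V. net E p u v - b v = 0"
      using sum_nonneg_eq_0_iff[OF assms(1), of "\<lambda>v. net E p u v - b v"] by blast
    then show ?thesis using lu by (intro exI[of _ u]) auto
  next
    case True
    then obtain e0 where e0: "e0 \<in> E" "l e0 < u e0" by blast
    have pos: "0 < (\<Sum>e\<in>E. u e - l e)"
      using assms(2) e0 less.prems(1) by (intro sum_pos2[of _ e0]) auto
    show ?thesis
    proof (cases "\<forall>X\<subseteq>V. 0 \<le> slack E p l (u(e0 := u e0 - 1)) b X")
      case True
      have "(\<Sum>e\<in>E. (u(e0 := u e0 - 1)) e - l e) = (\<Sum>e\<in>E. (u e - l e) - (if e = e0 then 1 else 0))"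
        by (rule sum.cong) auto
      also have "\<dots> = (\<Sum>e\<in>E. u e - l e) - 1"
        unfolding sum_subtractf[of "\<lambda>e. u e - l e"] using assms(2) e0(1) by simp
      finally have "nat (\<Sum>e\<in>E. (u(e0 := u e0 - 1)) e - l e) < nat (\<Sum>e\<in>E. u e - l e)"
        using pos by simp
      moreover have "\<forall>e\<in>E. l e \<le> (u(e0 := u e0 - 1)) e" using less.prems(1) e0(2) by auto
      ultimately obtain f where f: "\<forall>e\<in>E. l e \<le> f e \<and> f e \<le> (u(e0 := u e0 - 1)) e" "\<forall>v\<in>V. net E p f v = b v"
        using less.hyps[of "u(e0 := u e0 - 1)" l] True by blast
      have "f e \<le> u e" if "e \<in> E" for e
        using bspec[OF f(1) that] by (cases "e = e0") auto
      then show ?thesis using f by blast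
    next
      case False
      then obtain X where X: "X \<subseteq> V" "slack E p l u b X - of_bool (e0 \<in> leaving E p X) < 0"
        unfolding slack_decr_upper[OF assms(2)] by (auto simp: not_le)
      moreover have "0 \<le> slack E p l u b X" using X(1) less.prems(2) by blast
      ultimately have X': "slack E p l u b X = 0" "e0 \<in> leaving E p X"
        by (auto simp: of_bool_def split: if_splits)
      have "\<forall>Y\<subseteq>V. 0 \<le> slack E p (l(e0 := l e0 + 1)) u b Y"
      proof (rule ccontr)
        assume "\<not> (\<forall>Y\<subseteq>V. 0 \<le> slack E p (l(e0 := l e0 + 1)) u b Y)"
        then obtain Y where Y: "Y \<subseteq> V" "slack E p l u b Y - of_bool (e0 \<in> entering E p Y) < 0"
          unfolding slack_incr_lower[OF assms(2)] by (auto simp: not_le)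
        moreover have "0 \<le> slack E p l u b Y" using Y(1) less.prems(2) by blast
        ultimately have Y': "slack E p l u b Y = 0" "e0 \<in> entering E p Y"
          by (auto simp: of_bool_def split: if_splits)
        have "finite X" "finite Y" using X(1) Y(1) assms(1) finite_subset by blast+
        from slack_uncross[OF assms(2) this less.prems(1) X'(2) Y'(2), of b]
        have "slack E p l u b (X \<inter> Y) + slack E p l u b (X \<union> Y) < 0" using X'(1) Y'(1) e0(2) by simp
        moreover have "0 \<le> slack E p l u b (X \<inter> Y)" "0 \<le> slack E p l u b (X \<union> Y)"
          using less.prems(2) X(1) Y(1) by (simp_all add: le_infI1)
        ultimately show False by simp
      qed
      moreover have "(\<Sum>e\<in>E. u e - (l(e0 := l e0 + 1)) e) = (\<Sum>e\<in>E. (u e - l e) - (if e = e0 then 1 else 0))"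
        by (rule sum.cong) auto
      then have "(\<Sum>e\<in>E. u e - (l(e0 := l e0 + 1)) e) = (\<Sum>e\<in>E. u e - l e) - 1"
        unfolding sum_subtractf[of "\<lambda>e. u e - l e"] using assms(2) e0(1) by simp
      then have "nat (\<Sum>e\<in>E. u e - (l(e0 := l e0 + 1)) e) < nat (\<Sum>e\<in>E. u e - l e)"
        using pos by simp
      moreover have "\<forall>e\<in>E. (l(e0 := l e0 + 1)) e \<le> u e" using less.prems(1) e0(2) by auto
      ultimately obtain f where f: "\<forall>e\<in>E. (l(e0 := l e0 + 1)) e \<le> f e \<and> f e \<le> u e" "\<forall>v\<in>V. net E p f v = b v"
        using less.hyps[of u "l(e0 := l e0 + 1)"] by blast
      have "l e \<le> f e" if "e \<in> E" for e
        using bspec[OF f(1) that] by (cases "e = e0") auto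
      then show ?thesis using f by blast
    qed
  qed
qed

section \<open>Circular flows as cut conditions on an orientation\<close>

lemma net_out_in:
  assumes "finite (arcs D)" "\<And>e. e \<in> arcs D \<Longrightarrow> p e = (tail D e, head D e)"
  shows "net (arcs D) p f v = (\<Sum>e\<in>out_arcs D v. f e) - (\<Sum>e\<in>in_arcs D v. f e)"
proof -
  have "net (arcs D) p f v =
      (\<Sum>e\<in>arcs D. (if tail D e = v then f e else 0) - (if head D e = v then f e else 0))"
    unfolding net_def by (rule sum.cong) (auto simp: assms(2))
  then show ?thesis
    using assms(1) by (simp add: sum_subtractf sum.inter_filter out_arcs_def in_arcs_def)
qed

lemma has_circular_flowI:
  assumes "finite (edges G)" "orients (ends G) (edges G) p" "t \<ge> 2 * s" "s > 0"
    and "\<forall>e\<in>edges G. s \<le> \<bar>f e\<bar> \<and> \<bar>f e\<bar> \<le> t - s" "\<forall>v\<in>nodes G. net (edges G) p f v = 0"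
  shows "has_circular_flow G (of_int t / of_int s)"
proof -
  define D where "D = \<lparr>verts = nodes G, arcs = edges G, tail = (\<lambda>e. fst (p e)), head = (\<lambda>e. snd (p e))\<rparr>"
  have "orientation G D" using assms(2) by (simp add: D_def orientation_def orients_def)
  moreover have "(\<Sum>e\<in>out_arcs D v. f e) = (\<Sum>e\<in>in_arcs D v. f e)" if "v \<in> nodes G" for v
  proof -
    have "net (arcs D) p f v = (\<Sum>e\<in>out_arcs D v. f e) - (\<Sum>e\<in>in_arcs D v. f e)"
      by (rule net_out_in) (simp_all add: D_def assms(1))
    moreover have "net (arcs D) p f v = 0" using assms(6) that by (simp add: D_def)
    ultimately show ?thesis by simp
  qed
  moreover have "1 \<le> \<bar>f e\<bar> \<and> \<bar>f e\<bar> \<le> t - 1" if "e \<in> edges G" for e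
    using bspec[OF assms(5) that] assms(4) by linarith
  ultimately have "circular_flow G t s D f"
    using assms(3-5) unfolding circular_flow_def nowhere_zero_flow_def by blast
  then show ?thesis unfolding has_circular_flow_def by blast
qed

text \<open>Hoffman's condition for net outflow 0 and constant bounds \<open>s\<close> and
  \<open>t - s\<close>, divided by \<open>s\<close>. Only the ratio \<open>r\<close> survives, so
  the representation \<open>t / s\<close> no longer matters.\<close>

definition cut_balanced :: "('v, 'e) mgraph \<Rightarrow> rat \<Rightarrow> ('e \<Rightarrow> 'v \<times> 'v) \<Rightarrow> bool" where
  "cut_balanced G r p \<longleftrightarrow> orients (ends G) (edges G) p \<and> (\<forall>X\<subseteq>nodes G.
    of_nat (card (entering (edges G) p X)) \<le> (r - 1) * of_nat (card (leaving (edges G) p X)))"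

text \<open>Reversing the edges of negative value makes the flow positive. Across a cut the totals
  in both directions agree, each entering edge carries at least \<open>s\<close>, and each leaving
  edge at most \<open>t - s\<close>.\<close>

lemma circular_flow_imp_cut_balanced:
  assumes "multigraph G" "has_circular_flow G r"
  shows "2 \<le> r \<and> (\<exists>p. cut_balanced G r p)"
proof -
  obtain t s D f where r: "r = of_int t / of_int s" and F: "circular_flow G t s D f"
    using assms(2) unfolding has_circular_flow_def by blast
  have ts: "2 * s \<le> t" "0 < s" and D: "orientation G D"
    and f: "\<And>e. e \<in> edges G \<Longrightarrow> s \<le> \<bar>f e\<bar> \<and> \<bar>f e\<bar> \<le> t - s"
    and bal: "\<And>v. v \<in> nodes G \<Longrightarrow> (\<Sum>e\<in>out_arcs D v. f e) = (\<Sum>e\<in>in_arcs D v. f e)"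
    using F unfolding circular_flow_def nowhere_zero_flow_def by auto
  have fin: "finite (nodes G)" "finite (edges G)" using assms(1) by (auto simp: multigraph_def)
  have arcs: "arcs D = edges G" using D by (simp add: orientation_def)
  define p where "p e = (if 0 \<le> f e then (tail D e, head D e) else (head D e, tail D e))" for e
  have "orients (ends G) (edges G) p"
    using D by (auto simp: orients_def orientation_def p_def)
  moreover have "of_nat (card (entering (edges G) p X)) \<le> (r - 1) * of_nat (card (leaving (edges G) p X))"
    if X: "X \<subseteq> nodes G" for X
  proof -
    have "net (edges G) p (\<lambda>e. \<bar>f e\<bar>) v = 0" if "v \<in> nodes G" for v
    proof -
      have "net (edges G) p (\<lambda>e. \<bar>f e\<bar>) v = net (arcs D) (\<lambda>e. (tail D e, head D e)) f v"
        unfolding net_def arcs by (rule sum.cong) (auto simp: p_def)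
      also have "\<dots> = (\<Sum>e\<in>out_arcs D v. f e) - (\<Sum>e\<in>in_arcs D v. f e)"
        by (rule net_out_in) (simp_all add: arcs fin(2))
      also have "\<dots> = 0" using bal[OF that] by simp
      finally show ?thesis .
    qed
    then have "(\<Sum>v\<in>X. net (edges G) p (\<lambda>e. \<bar>f e\<bar>) v) = 0"
      using X by (intro sum.neutral) auto
    then have eq: "(\<Sum>e\<in>leaving (edges G) p X. \<bar>f e\<bar>) = (\<Sum>e\<in>entering (edges G) p X. \<bar>f e\<bar>)"
      using sum_net_cut[OF fin(2), of X p "\<lambda>e. \<bar>f e\<bar>"] X fin(1) finite_subset by fastforce
    have "int (card (entering (edges G) p X)) * s \<le> (\<Sum>e\<in>entering (edges G) p X. \<bar>f e\<bar>)"
      using f by (intro sum_bounded_below) (auto simp: entering_def)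
    also have "\<dots> = (\<Sum>e\<in>leaving (edges G) p X. \<bar>f e\<bar>)" using eq by simp
    also have "\<dots> \<le> int (card (leaving (edges G) p X)) * (t - s)"
      using f by (intro sum_bounded_above) (auto simp: leaving_def)
    finally have "of_int (int (card (entering (edges G) p X)) * s) \<le>
        (of_int (int (card (leaving (edges G) p X)) * (t - s)) :: rat)"
      by (simp only: of_int_le_iff)
    then show ?thesis using ts(2) by (simp add: r field_simps)
  qed
  ultimately have "cut_balanced G r p" unfolding cut_balanced_def by blast
  moreover have "2 \<le> r" using ts by (simp add: r field_simps)
  ultimately show ?thesis by blast
qed

lemma cut_balanced_imp_circular_flow:
  assumes G: "multigraph G" and "2 \<le> r" "cut_balanced G r p"
  shows "has_circular_flow G r"
proof -
  obtain t s where ts: "quotient_of r = (t, s)" by fastforce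
  have s: "s > 0" and r: "r = of_int t / of_int s"
    using quotient_of_denom_pos[OF ts] quotient_of_div[OF ts] by auto
  have "2 * of_int s \<le> (of_int t :: rat)" using assms(2) s by (simp add: r field_simps)
  then have t: "2 * s \<le> t" by (metis of_int_le_iff of_int_mult of_int_numeral)
  have fin: "finite (nodes G)" "finite (edges G)" using G by (auto simp: multigraph_def)
  have p: "orients (ends G) (edges G) p" using assms(3) by (simp add: cut_balanced_def)
  have "\<exists>f. (\<forall>e\<in>edges G. s \<le> f e \<and> f e \<le> t - s) \<and> (\<forall>v\<in>nodes G. net (edges G) p f v = 0)"
  proof (rule hoffman_circulation[OF fin])
    show "\<forall>e\<in>edges G. fst (p e) \<in> nodes G \<and> snd (p e) \<in> nodes G"
      using p G by (auto simp: orients_def multigraph_def)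
    show "\<forall>X\<subseteq>nodes G. 0 \<le> slack (edges G) p (\<lambda>e. s) (\<lambda>e. t - s) (\<lambda>v. 0) X"
    proof (intro allI impI)
      fix X assume "X \<subseteq> nodes G"
      then have "of_nat (card (entering (edges G) p X)) \<le> (r - 1) * of_nat (card (leaving (edges G) p X))"
        using assms(3) by (simp add: cut_balanced_def)
      then have "(of_int (int (card (entering (edges G) p X)) * s) :: rat) \<le>
          of_int (int (card (leaving (edges G) p X)) * (t - s))"
        using s by (simp add: r field_simps)
      then show "0 \<le> slack (edges G) p (\<lambda>e. s) (\<lambda>e. t - s) (\<lambda>v. 0) X"
        by (simp only: of_int_le_iff) (simp add: slack_def)
    qed
  qed (use t in auto)
  then obtain f where f: "\<forall>e\<in>edges G. s \<le> f e \<and> f e \<le> t - s" "\<forall>v\<in>nodes G. net (edges G) p f v = 0"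
    by blast
  have "\<forall>e\<in>edges G. s \<le> \<bar>f e\<bar> \<and> \<bar>f e\<bar> \<le> t - s"
  proof
    fix e assume "e \<in> edges G"
    then show "s \<le> \<bar>f e\<bar> \<and> \<bar>f e\<bar> \<le> t - s" using bspec[OF f(1), of e] s by simp
  qed
  then show ?thesis unfolding r by (rule has_circular_flowI[OF fin(2) p t s _ f(2)])
qed

text \<open>For a fixed orientation the least feasible \<open>r\<close> is the maximum of 2 and finitely many numbers
  \<open>1 + A / B\<close> with \<open>A, B \<le> |E|\<close>, so the infimum over all orientations is attained.\<close>

lemma flow_index_exists:
  assumes G: "multigraph G" and "has_circular_flow G r0"
  shows "\<exists>r \<le> r0. is_flow_index G r"
proof -
  define m where "m = card (edges G)"
  define C :: "rat set" where
    "C = insert 2 ((\<lambda>(a, b). 1 + of_nat a / of_nat b) ` ({..m} \<times> {..m}))"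
  define S where "S = {c \<in> C. has_circular_flow G c}"
  have fin: "finite (nodes G)" "finite (edges G)" using G by (auto simp: multigraph_def)
  have "finite S" by (simp add: S_def C_def)
  have below: "\<exists>c\<in>S. c \<le> r" if r: "has_circular_flow G r" for r
  proof -
    obtain p where "2 \<le> r" and p: "cut_balanced G r p"
      using circular_flow_imp_cut_balanced[OF G r] by blast
    \<comment> \<open>If no edge leaves \<open>X\<close>, division by zero gives
      \<open>q X = 1\<close>, which is harmless: the maximum is at least 2 anyway, and balance for
      \<open>r\<close> already shows that no edge enters \<open>X\<close>.\<close>
    define q where "q X = 1 + of_nat (card (entering (edges G) p X)) / (of_nat (card (leaving (edges G) p X)) :: rat)" for X
    define c where "c = Max (insert 2 (q ` Pow (nodes G)))"
    have fq: "finite (insert 2 (q ` Pow (nodes G)))" using fin(1) by simp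
    have "q X \<in> C" for X
    proof -
      have "card (entering (edges G) p X) \<le> m" "card (leaving (edges G) p X) \<le> m"
        unfolding m_def using fin(2) by (auto intro!: card_mono simp: entering_def leaving_def)
      then show ?thesis unfolding q_def C_def
        by (intro insertI2 image_eqI[where x = "(card (entering (edges G) p X), card (leaving (edges G) p X))"]) auto
    qed
    moreover have "c \<in> insert 2 (q ` Pow (nodes G))" unfolding c_def using fq by (intro Max_in) auto
    ultimately have "c \<in> C" by (auto simp: C_def)
    have cut: "of_nat (card (entering (edges G) p X)) \<le> (r - 1) * of_nat (card (leaving (edges G) p X))"
      if "X \<subseteq> nodes G" for X using p that by (simp add: cut_balanced_def)
    have "q X \<le> r" if "X \<subseteq> nodes G" for X
    proof (cases "card (leaving (edges G) p X) = 0")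
      case True
      then show ?thesis using \<open>2 \<le> r\<close> by (simp add: q_def)
    next
      case False
      then show ?thesis using cut[OF that] by (simp add: q_def field_simps)
    qed
    then have "c \<le> r" unfolding c_def using fq \<open>2 \<le> r\<close> by (subst Max_le_iff) auto
    have "q X \<le> c" if "X \<subseteq> nodes G" for X
      unfolding c_def using fq that by (intro Max_ge) auto
    have "cut_balanced G c p"
      unfolding cut_balanced_def
    proof (intro conjI allI impI)
      show "orients (ends G) (edges G) p" using p by (simp add: cut_balanced_def)
      fix X assume X: "X \<subseteq> nodes G"
      show "of_nat (card (entering (edges G) p X)) \<le> (c - 1) * of_nat (card (leaving (edges G) p X))"
      proof (cases "card (leaving (edges G) p X) = 0")
        case True
        then show ?thesis using cut[OF X] by simp
      next
        case False
        then show ?thesis using \<open>X \<subseteq> nodes G \<Longrightarrow> q X \<le> c\<close>[OF X] by (simp add: q_def field_simps)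
      qed
    qed
    moreover have "2 \<le> c" unfolding c_def using fq by (intro Max_ge) auto
    ultimately have "has_circular_flow G c" by (intro cut_balanced_imp_circular_flow[OF G])
    then show ?thesis using \<open>c \<in> C\<close> \<open>c \<le> r\<close> by (auto simp: S_def)
  qed
  have "S \<noteq> {}" using below[OF assms(2)] by blast
  have "is_flow_index G (Min S)"
    unfolding is_flow_index_def
  proof (intro conjI allI impI)
    show "has_circular_flow G (Min S)" using Min_in[OF \<open>finite S\<close> \<open>S \<noteq> {}\<close>] by (simp add: S_def)
    fix r assume "has_circular_flow G r"
    then obtain c where "c \<in> S" "c \<le> r" using below by blast
    then show "Min S \<le> r" using Min_le[OF \<open>finite S\<close> \<open>c \<in> S\<close>] by linarith
  qed
  moreover obtain c where "c \<in> S" "c \<le> r0" using below[OF assms(2)] by blast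
  then have "Min S \<le> r0" using Min_le[OF \<open>finite S\<close> \<open>c \<in> S\<close>] by linarith
  ultimately show ?thesis by blast
qed

section \<open>From a strong orientation to a flow below 3\<close>

lemma of_int_three_eq_0: "of_int k = (0 :: 3) \<longleftrightarrow> 3 dvd k"
  by (simp add: of_int_eq_0_iff_char_dvd)

text \<open>The circulation \<open>1 - 3 \<chi>\<close> takes the values 1 and -2; adding a small positive circulation \<open>g\<close> to
  a multiple \<open>N\<close> of it pushes all values strictly inside the bounds of a 3-flow.\<close>

lemma strongly_realizable_zero_imp_flow:
  assumes G: "multigraph G" and "strongly_realizable (ends G) (nodes G) (edges G) 0"
  shows "\<exists>r<3. has_circular_flow G r"
proof -
  let ?V = "nodes G" and ?E = "edges G"
  have fin: "finite ?V" "finite ?E" using G by (auto simp: multigraph_def)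
  obtain p where p: "orients (ends G) ?E p" "strong ?V ?E p" "(\<Sum>e\<in>?E. arc (p e)) = 0"
    using assms(2) unfolding strongly_realizable_def by blast
  have inV: "\<forall>e\<in>?E. fst (p e) \<in> ?V \<and> snd (p e) \<in> ?V"
    using p(1) G by (auto simp: orients_def multigraph_def)
  have dvd: "3 dvd net ?E p (\<lambda>e. 1) v" for v
  proof -
    have "(of_int (net ?E p (\<lambda>e. 1) v) :: 3) = (\<Sum>e\<in>?E. arc (p e) v)"
      unfolding net_def of_int_sum by (rule sum.cong) (auto simp: arc_def)
    also have "\<dots> = 0" using fun_cong[OF p(3), of v] by (simp add: sum_fun_apply)
    finally show ?thesis by (simp only: of_int_three_eq_0)
  qed
  define b where "b v = net ?E p (\<lambda>e. 1) v div 3" for v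
  have b: "net ?E p (\<lambda>e. 1) v = 3 * b v" for v
    unfolding b_def using dvd_mult_div_cancel[OF dvd[of v]] by simp
  have b_cut: "3 * (\<Sum>v\<in>X. b v) = int (card (leaving ?E p X)) - int (card (entering ?E p X))"
    if "X \<subseteq> ?V" for X
  proof -
    have "3 * (\<Sum>v\<in>X. b v) = (\<Sum>v\<in>X. net ?E p (\<lambda>e. 1) v)"
      unfolding sum_distrib_left by (rule sum.cong) (simp_all only: b)
    also have "\<dots> = (\<Sum>e\<in>leaving ?E p X. 1) - (\<Sum>e\<in>entering ?E p X. 1)"
      by (rule sum_net_cut[OF fin(2) finite_subset[OF that fin(1)]])
    finally show ?thesis by simp
  qed
  have cutV: "leaving ?E p ?V = {}" "entering ?E p ?V = {}"
    using inV by (auto simp: leaving_def entering_def)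
  \<comment> \<open>This produces the 0/1 function of the edges that get value -2. Its net outflow
    must be a third of that of the constant 1, so that \<open>1 - 3 * c e\<close> balances.\<close>
  have "\<exists>f. (\<forall>e\<in>?E. 0 \<le> f e \<and> f e \<le> 1) \<and> (\<forall>v\<in>?V. net ?E p f v = b v)"
  proof (rule hoffman_circulation[OF fin inV])
    show "(\<Sum>v\<in>?V. b v) = 0" using b_cut[of ?V] cutV by simp
    show "\<forall>X\<subseteq>?V. 0 \<le> slack ?E p (\<lambda>e. 0) (\<lambda>e. 1) b X"
    proof (intro allI impI)
      fix X assume "X \<subseteq> ?V"
      from b_cut[OF this] have "(\<Sum>v\<in>X. b v) \<le> int (card (leaving ?E p X))" by linarith
      then show "0 \<le> slack ?E p (\<lambda>e. 0) (\<lambda>e. 1) b X" by (simp add: slack_def)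
    qed
  qed simp
  then obtain c where c: "\<forall>e\<in>?E. 0 \<le> c e \<and> c e \<le> 1" "\<forall>v\<in>?V. net ?E p c v = b v" by blast
  \<comment> \<open>Large enough for a single leaving edge at capacity \<open>K\<close> to outweigh
    all entering edges at their lower bound 1; strongness provides such an edge in every proper
    cut.\<close>
  define K where "K = int (card ?E) + 1"
  have "\<exists>f. (\<forall>e\<in>?E. 1 \<le> f e \<and> f e \<le> K) \<and> (\<forall>v\<in>?V. net ?E p f v = 0)"
  proof (rule hoffman_circulation[OF fin inV])
    show "\<forall>X\<subseteq>?V. 0 \<le> slack ?E p (\<lambda>e. 1) (\<lambda>e. K) (\<lambda>v. 0) X"
    proof (intro allI impI)
      fix X assume "X \<subseteq> ?V"
      have "card (entering ?E p X) \<le> card ?E"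
        using fin(2) by (intro card_mono) (auto simp: entering_def)
      then have le: "int (card (entering ?E p X)) \<le> K" by (simp add: K_def)
      show "0 \<le> slack ?E p (\<lambda>e. 1) (\<lambda>e. K) (\<lambda>v. 0) X"
      proof (cases "leaving ?E p X = {}")
        case True
        then have "X = {} \<or> X = ?V"
          using p(2) \<open>X \<subseteq> ?V\<close> unfolding strong_def leaving_def by blast
        then have "entering ?E p X = {}" using cutV by (auto simp: entering_def)
        then show ?thesis using True by (simp add: slack_def)
      next
        case False
        then have "1 \<le> int (card (leaving ?E p X))"
          using fin(2) by (simp add: leaving_def card_gt_0_iff Suc_le_eq)
        moreover have "0 \<le> K" by (simp add: K_def)
        ultimately have "1 * K \<le> int (card (leaving ?E p X)) * K" by (rule mult_right_mono)
        then show ?thesis using le by (simp add: slack_def)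
      qed
    qed
  qed (auto simp: K_def)
  then obtain g where g: "\<forall>e\<in>?E. 1 \<le> g e \<and> g e \<le> K" "\<forall>v\<in>?V. net ?E p g v = 0" by blast
  \<comment> \<open>With \<open>g\<close> between 1 and \<open>K = N - 1\<close>, both
    \<open>N + g e\<close> and \<open>- 2 * N + g e\<close> have absolute value between
    \<open>N + 1\<close> and \<open>2 * N - 1\<close>, which are the bounds of a circular flow with
    \<open>t = 3 * N\<close> and \<open>s = N + 1\<close>.\<close>
  define N where "N = K + 1"
  define f where "f e = N * (1 - 3 * c e) + g e" for e
  have "net ?E p f v = N * (net ?E p (\<lambda>e. 1) v - 3 * net ?E p c v) + net ?E p g v" for v
    unfolding net_def f_def by (simp add: algebra_simps sum.distrib sum_subtractf sum_distrib_left)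
  then have net: "\<forall>v\<in>?V. net ?E p f v = 0" using b c(2) g(2) by simp
  have "\<forall>e\<in>?E. N + 1 \<le> \<bar>f e\<bar> \<and> \<bar>f e\<bar> \<le> 3 * N - (N + 1)"
  proof
    fix e assume e: "e \<in> ?E"
    have "c e = 0 \<or> c e = 1" using c(1) e by force
    then show "N + 1 \<le> \<bar>f e\<bar> \<and> \<bar>f e\<bar> \<le> 3 * N - (N + 1)"
      using bspec[OF g(1) e] by (auto simp: f_def N_def)
  qed
  then have "has_circular_flow G (of_int (3 * N) / of_int (N + 1))"
    using net by (intro has_circular_flowI[OF fin(2) p(1)]) (auto simp: N_def K_def)
  moreover have "of_int (3 * N) / of_int (N + 1) < (3 :: rat)"
  proof -
    have "0 < N + 1" by (simp add: N_def K_def)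
    then have "0 < (of_int (N + 1) :: rat)" by (simp only: of_int_0_less_iff)
    then show ?thesis by (simp add: divide_less_eq)
  qed
  ultimately show ?thesis by blast
qed

theorem theorem1p8:
  fixes G T1 T2 :: "('v, 'e) mgraph"
  assumes "multigraph G"
    and "spanning_triangle_tree T1 G"
    and "spanning_triangle_tree T2 G"
    and "edges T1 \<inter> edges T2 = {}"
  shows "\<exists>r. is_flow_index G r \<and> r < 3"
proof -
  have ttree: "ttree (ends G) (nodes G) (edges T) \<and> edges T \<subseteq> edges G"
    if "spanning_triangle_tree T G" for T
    using that triangle_tree_imp_ttree[of T "ends G"]
    by (auto simp: spanning_triangle_tree_def sub_multigraph_def)
  have "strongly_realizable (ends G) (nodes G) (edges G) 0"
    by (rule two_ttrees_strongly_realizable[of _ _ "edges T1" "edges T2"])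
      (use ttree[OF assms(2)] ttree[OF assms(3)] assms(1,4) in \<open>auto simp: multigraph_def\<close>)
  then obtain r where "r < 3" "has_circular_flow G r"
    using strongly_realizable_zero_imp_flow[OF assms(1)] by blast
  then show ?thesis using flow_index_exists[OF assms(1)] by (meson le_less_trans)
qed

end
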